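(* Let $f$ and $\psi$ be convex, closed and proper over the convex domain $\operatorname{dom}\psi$, let $\|\nabla f(x)-\nabla f(y)\|\le L\|x-y\|$ for all $x,y\in\operatorname{dom}\psi$, and let the stochastic gradient oracle $g(x,\xi)$ satisfy $\mathbb E[g(x,\xi)]=\nabla f(x)$ and $\mathbb E_\xi\|g(x,\xi)-\nabla f(x)\|^2\le\sigma_g^2$ for all $x\in\operatorname{dom}\psi$. Consider the inexact dual averaging method and its virtual iterates $\tilde x_t$ (see context), and suppose $\gamma_{t-1}\ge4a_tL$ for all $t$. Then for any (fixed) $x\in\operatorname{dom}\psi$ and any $T\ge1$, $$\sum_{t=0}^{T-1}\mathbb E\big[a_t(F(\tilde x_{t+1})-F(x))\big]+\frac{\gamma_{T-1}}2\mathbb E\|x-\tilde x_T\|^2\le\frac{\gamma_{T-1}}2\|x-x_0\|^2+L\sum_{t=0}^{T-1}\frac{a_t}{\gamma_{t-1}^2}\mathbb E\|e_t\|^2+\sum_{t=0}^{T-1}\frac{a_t^2\sigma_g^2}{\gamma_{t-1}}.$$ In addition, $$\sum_{t=0}^{T-1}\left(\frac{\gamma_t+\gamma_{t-1}-a_tL}{2a_t}r_t^2+\langle\hat g_t-\nabla f(x_t),x_{t+1}-x_t\rangle\right)\le F_0+\frac12\sum_{t=0}^{T-1}(\beta_t\rho_t^2-\beta_t\rho_{t+1}^2),$$ where $\beta_t=\frac{\gamma_t-\gamma_{t-1}}{a_t}$, $\rho_t^2=\|x_t-x_0\|^2$, $r_t^2=\|x_{t+1}-x_t\|^2$ and $F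_0=F(x_0)-F^\star$.
   Context: Problem: $F^\star=\min_{x\in\operatorname{dom}\psi}[F(x)=f(x)+\psi(x)]$ (a solution exists), with $f:\mathbb R^d\to\mathbb R$ and $\psi:\mathbb R^d\to\mathbb R\cup\{+\infty\}$; $\|\cdot\|$ is the Euclidean norm. Inexact dual averaging: given $x_0\in\operatorname{dom}\psi$, positive numbers $a_t$ and a non-decreasing sequence of positive numbers $\gamma_t$ ($t\ge0$), with the convention $\gamma_{-1}=\gamma_0$. For $t=0,1,\dots$: let $g_t=g(x_t,\xi_t)$, where $\xi_t$ is a fresh copy of $\xi$ independent of the past (so independent of $x_0,\dots,x_t$ and $\hat g_0,\dots,\hat g_{t-1}$); obtain some arbitrary estimate $\hat g_t\in\mathbb R^d$ of $g_t$; set $$x_{t+1}=\arg\min_{x\in\operatorname{dom}\psi}\Big\{\sum_{k=0}^ta_k\big(f(x_k)+\langle\hat g_k,x-x_k\rangle+\psi(x)\big)+\tfrac{\gamma_t}2\|x-x_0\|^2\Big\}.$$ Virtual iterates: $\tilde x_0=x_0$ and $$\tilde x_{t+1}=\arg\min_{x\in\operatorname{dom}\psi}\Big\{\sum_{k=0}^ta_k\big(f(x_k)+\langle g_k,x-x_k\rangle+\psi(x)\big)+\tfrac{\gamma_t}2\|x-x_0\|^2\Big\}.$$ Accumulated error: $e_t=\sum_{k=0}^{t-1}a_k(\hat g_k-g_k)$, $e_0=0$. *)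

theory Defs
  imports "HOL-Probability.Probability"
begin

definition effective_dom :: "('a \<Rightarrow> ereal) \<Rightarrow> 'a set"
  where "effective_dom \<psi> = {x. \<psi> x < \<infinity>}"

definition proper_closed_convex :: "('a::real_normed_vector \<Rightarrow> ereal) \<Rightarrow> bool"
  where "proper_closed_convex \<psi> \<longleftrightarrow>
    effective_dom \<psi> \<noteq> {} \<and> (\<forall>x. \<psi> x \<noteq> -\<infinity>) \<and>
    closed {(x, r::real). \<psi> x \<le> ereal r} \<and> convex {(x, r::real). \<psi> x \<le> ereal r}"

(* A real-valued f is only required to be convex over S; closedness is that of the
   epigraph of f restricted to S, relative to S \<times> \<real> (i.e. lower semicontinuity on S),
   so that S itself need not be closed.  Properness is automatic for S nonempty. *)
definition closed_convex_on :: "'a::real_normed_vector set \<Rightarrow> ('a \<Rightarrow> real) \<Rightarrow> bool"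
  where "closed_convex_on S f \<longleftrightarrow>
    convex_on S f \<and> closedin (top_of_set (S \<times> UNIV)) {(x, r). x \<in> S \<and> f x \<le> r}"

definition composite :: "('a \<Rightarrow> real) \<Rightarrow> ('a \<Rightarrow> ereal) \<Rightarrow> 'a \<Rightarrow> ereal"
  where "composite f \<psi> x = ereal (f x) + \<psi> x"

(* The model minimized by dual averaging in step t, for query points p 0, p 1, ...
   and search directions v 0, v 1, ... *)
definition da_model ::
  "('a::euclidean_space \<Rightarrow> real) \<Rightarrow> ('a \<Rightarrow> ereal) \<Rightarrow> (nat \<Rightarrow> real) \<Rightarrow> (nat \<Rightarrow> real) \<Rightarrow> 'a \<Rightarrow>
   (nat \<Rightarrow> 'a) \<Rightarrow> (nat \<Rightarrow> 'a) \<Rightarrow> nat \<Rightarrow> 'a \<Rightarrow> ereal"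
  where "da_model f \<psi> a \<gamma> x0 p v t y =
    (\<Sum>k\<le>t. ereal (a k) * (ereal (f (p k) + v k \<bullet> (y - p k)) + \<psi> y))
      + ereal (\<gamma> t / 2 * (norm (y - x0))\<^sup>2)"

(* z is the sequence of minimizers of the models built from p and v.  The actual method is
   the case z = p with v the estimates; the virtual iterates keep the query points p of the
   actual method but use the stochastic gradients as v.  The minimizers are unique. *)
definition da_iterates ::
  "('a::euclidean_space \<Rightarrow> real) \<Rightarrow> ('a \<Rightarrow> ereal) \<Rightarrow> (nat \<Rightarrow> real) \<Rightarrow> (nat \<Rightarrow> real) \<Rightarrow> 'a \<Rightarrow>
   (nat \<Rightarrow> 'a) \<Rightarrow> (nat \<Rightarrow> 'a) \<Rightarrow> (nat \<Rightarrow> 'a) \<Rightarrow> bool"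
  where "da_iterates f \<psi> a \<gamma> x0 p v z \<longleftrightarrow>
    z 0 = x0 \<and>
    (\<forall>t. is_arg_min (da_model f \<psi> a \<gamma> x0 p v t) (\<lambda>y. y \<in> effective_dom \<psi>) (z (Suc t)))"

definition accumulated_error ::
  "(nat \<Rightarrow> real) \<Rightarrow> (nat \<Rightarrow> 'a::real_vector) \<Rightarrow> (nat \<Rightarrow> 'a) \<Rightarrow> nat \<Rightarrow> 'a"
  where "accumulated_error a ghat g t = (\<Sum>k<t. a k *\<^sub>R (ghat k - g k))"

(* The random variables revealed before step t.  The iterates x 0, ..., x t are functions of
   the estimates ghat 0, ..., ghat (t - 1) and of the deterministic x0. *)
definition past ::
  "'w measure \<Rightarrow> 's measure \<Rightarrow> (nat \<Rightarrow> 'w \<Rightarrow> 's) \<Rightarrow> (nat \<Rightarrow> 'w \<Rightarrow> 'a::euclidean_space) \<Rightarrow>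
   nat \<Rightarrow> 'w measure"
  where "past M D \<xi> ghat t =
    vimage_algebra (space M) (\<lambda>\<omega>. \<lambda>k\<in>{..<t}. (\<xi> k \<omega>, ghat k \<omega>))
      (Pi\<^sub>M {..<t} (\<lambda>_. D \<Otimes>\<^sub>M borel))"

(* Expectation with values in the extended reals; the Bochner integral would be 0 for
   non-integrable functions.  Since \<infinity> - \<infinity> = \<infinity> in ereal, an upper bound on the
   expectation is never satisfied by accident. *)
definition ereal_expectation :: "'w measure \<Rightarrow> ('w \<Rightarrow> ereal) \<Rightarrow> ereal"
  where "ereal_expectation M Y =
    enn2ereal (\<integral>\<^sup>+ \<omega>. e2ennreal (Y \<omega>) \<partial>M) - enn2ereal (\<integral>\<^sup>+ \<omega>. e2ennreal (- Y \<omega>) \<partial>M)"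

lemma ereal_expectation_ereal:
  assumes "integrable M Y"
  shows "ereal_expectation M (\<lambda>\<omega>. ereal (Y \<omega>)) = ereal (\<integral>\<omega>. Y \<omega> \<partial>M)"
proof -
  have "(\<integral>\<^sup>+ \<omega>. ennreal (Y \<omega>) \<partial>M) < \<infinity>" "(\<integral>\<^sup>+ \<omega>. ennreal (- Y \<omega>) \<partial>M) < \<infinity>"
    using assms by (auto simp: real_integrable_def less_top)
  then obtain p q where pq: "0 \<le> p" "0 \<le> q" "(\<integral>\<^sup>+ \<omega>. ennreal (Y \<omega>) \<partial>M) = ennreal p"
      "(\<integral>\<^sup>+ \<omega>. ennreal (- Y \<omega>) \<partial>M) = ennreal q"
    by (metis ennreal_cases infinity_ennreal_def order_less_irrefl)
  then show ?thesis
    by (simp add: ereal_expectation_def real_lebesgue_integral_def[OF assms] e2ennreal_ereal)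
qed

end

theory Submission
  imports Defs
begin

text \<open>Every model minimized by the method is \<open>\<gamma> t\<close>-strongly convex, so its minimizer depends
  Lipschitz continuously, with constant \<open>1 / \<gamma> t\<close>, on the accumulated search direction. Hence the
  actual and the virtual iterates are at distance at most \<open>\<parallel>e t\<parallel> / \<gamma> (t - 1)\<close>, and the iterates are
  measurable functions of the past. The usual potential argument for the virtual iterates, together
  with the descent lemma at the actual query points, gives the first bound pathwise, up to the terms
  \<open>a t \<langle>\<delta> t, Xt t - x\<rangle>\<close> with \<open>\<delta> t\<close> the gradient noise. These have mean zero once \<open>Xt t\<close> is square
  integrable, which follows inductively from square integrability of the accumulated errors (or from
  \<open>L = 0\<close>, when the gradient is constant); if an error is not square integrable and \<open>L > 0\<close>, the
  right-hand side is infinite. The second bound adds the strong convexity inequalities of two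
  consecutive models at each other's minimizers and telescopes.\<close>

section \<open>Convexity and smoothness\<close>

lemma proper_real_of_ereal:
  assumes "proper_closed_convex \<psi>" "y \<in> effective_dom \<psi>"
  shows "\<psi> y = ereal (real_of_ereal (\<psi> y))"
  using assms by (auto simp: proper_closed_convex_def effective_dom_def ereal_real)

text \<open>Convexity of the epigraph is applied to the graph points over \<open>x\<close> and
  \<open>y\<close>. Since \<psi> is finite on its effective domain, the resulting
  \<open>ereal\<close> inequality carries over to real values.\<close>

lemma convex_on_real_of_ereal:
  assumes "proper_closed_convex \<psi>"
  shows "convex_on (effective_dom \<psi>) (\<lambda>y. real_of_ereal (\<psi> y))"
proof -
  have combination: "\<psi> (u *\<^sub>R x + v *\<^sub>R y) \<le> ereal (u * real_of_ereal (\<psi> x) + v * real_of_ereal (\<psi> y))"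
    if "x \<in> effective_dom \<psi>" "y \<in> effective_dom \<psi>" "0 \<le> u" "0 \<le> v" "u + v = 1" for x y and u v :: real
  proof -
    have "convex {(x, r::real). \<psi> x \<le> ereal r}"
      using assms by (simp add: proper_closed_convex_def)
    moreover have "(x, real_of_ereal (\<psi> x)) \<in> {(x, r::real). \<psi> x \<le> ereal r}"
      "(y, real_of_ereal (\<psi> y)) \<in> {(x, r::real). \<psi> x \<le> ereal r}"
      using proper_real_of_ereal[OF assms] that by (metis (mono_tags, lifting) case_prodI mem_Collect_eq order_refl)+
    ultimately have "u *\<^sub>R (x, real_of_ereal (\<psi> x)) + v *\<^sub>R (y, real_of_ereal (\<psi> y)) \<in> {(x, r::real). \<psi> x \<le> ereal r}"
      using that by (intro convexD) auto
    then show ?thesis by simp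
  qed
  have dom: "u *\<^sub>R x + v *\<^sub>R y \<in> effective_dom \<psi>"
    if "x \<in> effective_dom \<psi>" "y \<in> effective_dom \<psi>" "0 \<le> u" "0 \<le> v" "u + v = 1" for x y and u v :: real
    using combination[OF that] by (auto simp: effective_dom_def)
  show ?thesis
    unfolding convex_on_def
  proof (intro conjI ballI allI impI)
    show "convex (effective_dom \<psi>)"
      using dom by (auto simp: convex_def)
    fix x y and u v :: real
    assume *: "x \<in> effective_dom \<psi>" "y \<in> effective_dom \<psi>" "0 \<le> u" "0 \<le> v" "u + v = 1"
    show "real_of_ereal (\<psi> (u *\<^sub>R x + v *\<^sub>R y)) \<le> u * real_of_ereal (\<psi> x) + v * real_of_ereal (\<psi> y)"
      using combination[OF *] proper_real_of_ereal[OF assms dom[OF *]] by (metis ereal_less_eq(3))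
  qed
qed

text \<open>Each sublevel set at a real height is a horizontal slice of the closed epigraph, hence
  closed.\<close>

lemma borel_measurable_closed_convex:
  assumes "proper_closed_convex \<psi>"
  shows "\<psi> \<in> borel_measurable borel"
proof -
  have epi: "closed {(x, r::real). \<psi> x \<le> ereal r}" and fin: "\<And>x. \<psi> x \<noteq> -\<infinity>"
    using assms by (auto simp: proper_closed_convex_def)
  have "closed (\<psi> -` {..b})" for b
  proof (cases b)
    case (real r)
    have "closed ((\<lambda>x. (x, r)) -` {(x, r::real). \<psi> x \<le> ereal r})"
      by (rule closed_vimage[OF epi]) (intro continuous_intros)
    also have "(\<lambda>x. (x, r)) -` {(x, r::real). \<psi> x \<le> ereal r} = \<psi> -` {..b}"
      using real by auto
    finally show ?thesis .
  next
    case PInf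
    then have "\<psi> -` {..b} = UNIV" by auto
    then show ?thesis by simp
  next
    case MInf
    with fin have "\<psi> -` {..b} = {}" by (auto simp: fun_eq_iff)
    then show ?thesis by simp
  qed
  then show ?thesis
    unfolding borel_measurable_iff_Iic_ereal by (auto intro: borel_closed)
qed

text \<open>Comparing \<open>z\<close> with the point \<open>w\<close> of the segment from
  \<open>z\<close> to \<open>y\<close> at parameter \<open>u\<close>, the quadratic term gains
  exactly \<open>c / 2 * u * (1 - u) * (norm (y - z))\<^sup>2\<close>. Dividing by \<open>u\<close>
  and letting \<open>u\<close> tend to 0 from the right leaves the full gain.\<close>

lemma strongly_convex_minimizer:
  fixes h :: "'a::real_inner \<Rightarrow> real"
  assumes h: "convex_on S h" and z: "z \<in> S" and y: "y \<in> S" and c: "c \<ge> 0"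
    and min: "\<And>w. w \<in> S \<Longrightarrow> h z + c / 2 * (norm (z - x0))\<^sup>2 \<le> h w + c / 2 * (norm (w - x0))\<^sup>2"
  shows "h z + c / 2 * (norm (z - x0))\<^sup>2 + c / 2 * (norm (y - z))\<^sup>2 \<le> h y + c / 2 * (norm (y - x0))\<^sup>2"
proof -
  define H where "H w = h w + c / 2 * (norm (w - x0))\<^sup>2" for w
  have step: "H z + c / 2 * (1 - u) * (norm (y - z))\<^sup>2 \<le> H y" if u: "0 < u" "u \<le> 1" for u
  proof -
    define w where "w = (1 - u) *\<^sub>R z + u *\<^sub>R y"
    have w: "w \<in> S"
      unfolding w_def using h z y u by (intro convexD) (auto simp: convex_on_def)
    have "h w \<le> (1 - u) * h z + u * h y"
      unfolding w_def using h z y u by (auto simp: convex_on_def)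
    moreover have "(norm (w - x0))\<^sup>2 = (1 - u) * (norm (z - x0))\<^sup>2 + u * (norm (y - x0))\<^sup>2
        - u * (1 - u) * (norm (y - z))\<^sup>2"
      by (simp add: w_def power2_norm_eq_inner inner_simps algebra_simps inner_commute)
    from arg_cong[OF this, of "\<lambda>r. c / 2 * r"]
    have "c / 2 * (norm (w - x0))\<^sup>2 = (1 - u) * (c / 2 * (norm (z - x0))\<^sup>2)
        + u * (c / 2 * (norm (y - x0))\<^sup>2) - c / 2 * (u * (1 - u) * (norm (y - z))\<^sup>2)"
      by (simp add: algebra_simps add_divide_distrib diff_divide_distrib)
    moreover have "H z \<le> H w"
      using min[OF w] by (simp add: H_def)
    ultimately have "H z \<le> (1 - u) * H z + u * H y - c / 2 * (u * (1 - u) * (norm (y - z))\<^sup>2)"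
      by (simp add: H_def algebra_simps)
    then have "u * (H z + c / 2 * (1 - u) * (norm (y - z))\<^sup>2) \<le> u * H y"
      by (simp add: algebra_simps diff_divide_distrib)
    then show ?thesis
      using u by simp
  qed
  have "((\<lambda>u. H z + c / 2 * (1 - u) * (norm (y - z))\<^sup>2) \<longlongrightarrow> H z + c / 2 * (1 - 0) * (norm (y - z))\<^sup>2) (at_right 0)"
    by (intro tendsto_intros)
  moreover have "\<forall>\<^sub>F u in at_right 0. H z + c / 2 * (1 - u) * (norm (y - z))\<^sup>2 \<le> H y"
    using eventually_at_right_real[OF zero_less_one]
    by eventually_elim (rule step; simp)
  ultimately have "H z + c / 2 * (1 - 0) * (norm (y - z))\<^sup>2 \<le> H y"
    by (rule tendsto_upperbound) simp
  then show ?thesis by (simp add: H_def)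
qed

section \<open>First-order inequalities from gradients along segments\<close>

lemma gderiv_line:
  assumes "GDERIV f (x + t *\<^sub>R d) :> G"
  shows "((\<lambda>t. f (x + t *\<^sub>R d)) has_real_derivative d \<bullet> G) (at t within A)"
proof -
  have f: "(f has_derivative (\<lambda>h. h \<bullet> G)) (at (x + t *\<^sub>R d))"
    using assms by (simp add: gderiv_def)
  have "((\<lambda>t. x + t *\<^sub>R d) has_derivative (\<lambda>t. t *\<^sub>R d)) (at t within A)"
    by (auto intro!: derivative_eq_intros)
  from has_derivative_compose[OF this f] show ?thesis
    by (simp add: has_field_derivative_def mult.commute[of _ "d \<bullet> G"])
qed

text \<open>Convexity bounds the difference quotients along the segment towards \<open>y\<close> by
  \<open>f y - f x\<close>; their limit from the right is the directional derivative at
  \<open>x\<close>.\<close>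

lemma convex_on_above_gradient:
  assumes f: "convex_on S f" and x: "x \<in> S" and y: "y \<in> S" and G: "GDERIV f x :> G"
  shows "f x + G \<bullet> (y - x) \<le> f y"
proof -
  have "((\<lambda>t. f (x + t *\<^sub>R (y - x))) has_real_derivative (y - x) \<bullet> G) (at_right 0)"
    using G by (intro gderiv_line) simp
  then have "((\<lambda>t. (f (x + t *\<^sub>R (y - x)) - f x) / t) \<longlongrightarrow> (y - x) \<bullet> G) (at_right 0)"
    by (simp add: has_field_derivative_iff)
  moreover have "\<forall>\<^sub>F t in at_right (0::real). (f (x + t *\<^sub>R (y - x)) - f x) / t \<le> f y - f x"
    using eventually_at_right_real[OF zero_less_one]
  proof eventually_elim
    case (elim t)
    have "f ((1 - t) *\<^sub>R x + t *\<^sub>R y) \<le> (1 - t) * f x + t * f y"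
      using f x y elim by (auto simp: convex_on_def)
    moreover have "(1 - t) *\<^sub>R x + t *\<^sub>R y = x + t *\<^sub>R (y - x)"
      by (simp add: algebra_simps)
    ultimately have "f (x + t *\<^sub>R (y - x)) - f x \<le> (f y - f x) * t"
      by (simp add: algebra_simps)
    then show ?case
      using elim by (simp add: divide_le_eq)
  qed
  ultimately have "(y - x) \<bullet> G \<le> f y - f x"
    by (rule tendsto_upperbound) simp
  then show ?thesis by (simp add: inner_commute)
qed

text \<open>Along the segment, the function minus its quadratic upper model, called
  \<open>\<phi>\<close> below, has a nonpositive derivative: Cauchy-Schwarz and the Lipschitz bound
  control the change of the gradient by \<open>L * t * norm d\<close>.\<close>

lemma lipschitz_gradient_descent:
  assumes S: "convex S" and x: "x \<in> S" and y: "y \<in> S"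
    and G: "\<And>y. y \<in> S \<Longrightarrow> GDERIV f y :> G y" and L: "L-lipschitz_on S G"
  shows "f y \<le> f x + G x \<bullet> (y - x) + L / 2 * (norm (y - x))\<^sup>2"
proof -
  define d where "d = y - x"
  define \<phi> where "\<phi> t = f (x + t *\<^sub>R d) - t * (d \<bullet> G x) - L / 2 * t\<^sup>2 * (norm d)\<^sup>2" for t
  have "\<phi> 1 \<le> \<phi> 0"
  proof (rule DERIV_nonpos_imp_nonincreasing[of 0 1], simp)
    fix t :: real assume t: "0 \<le> t" "t \<le> 1"
    have "x + t *\<^sub>R d = (1 - t) *\<^sub>R x + t *\<^sub>R y"
      by (simp add: d_def algebra_simps)
    then have S': "x + t *\<^sub>R d \<in> S"
      using S x y t by (auto intro: convexD)
    have "(\<phi> has_real_derivative (d \<bullet> G (x + t *\<^sub>R d) - d \<bullet> G x - L * t * (norm d)\<^sup>2)) (at t)"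
      unfolding \<phi>_def
      by (rule derivative_eq_intros gderiv_line[OF G[OF S']] refl)+ simp
    moreover have "d \<bullet> G (x + t *\<^sub>R d) - d \<bullet> G x \<le> L * t * (norm d)\<^sup>2"
    proof -
      have "d \<bullet> (G (x + t *\<^sub>R d) - G x) \<le> norm d * norm (G (x + t *\<^sub>R d) - G x)"
        by (rule norm_cauchy_schwarz)
      also have "norm (G (x + t *\<^sub>R d) - G x) \<le> L * norm (t *\<^sub>R d)"
        using lipschitz_onD[OF L S' x] by (simp add: dist_norm)
      then have "norm d * norm (G (x + t *\<^sub>R d) - G x) \<le> norm d * (L * norm (t *\<^sub>R d))"
        by (rule mult_left_mono) simp
      also have "\<dots> = L * t * (norm d)\<^sup>2"
        using t by (simp add: power2_eq_square)
      finally show ?thesis by (simp add: inner_diff_right)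
    qed
    ultimately show "\<exists>y. (\<phi> has_real_derivative y) (at t) \<and> y \<le> 0"
      by (intro exI conjI) auto
  qed
  then show ?thesis
    by (simp add: \<phi>_def d_def inner_commute)
qed

section \<open>Dual averaging with arbitrary search directions\<close>

text \<open>Up to an additive constant, this is the model of step \<open>t - 1\<close>; for \<open>t = 0\<close> only the
  regularizer is left, with weight \<open>\<gamma> 0\<close>, so that the starting point is its minimizer as well.\<close>

definition da_potential :: "('a::real_inner \<Rightarrow> real) \<Rightarrow> (nat \<Rightarrow> real) \<Rightarrow> (nat \<Rightarrow> real) \<Rightarrow> 'a \<Rightarrow>
    (nat \<Rightarrow> 'a) \<Rightarrow> nat \<Rightarrow> 'a \<Rightarrow> real"
  where "da_potential h a \<gamma> x0 v t y =
    (\<Sum>k<t. a k *\<^sub>R v k) \<bullet> y + (\<Sum>k<t. a k) * h y + \<gamma> (t - 1) / 2 * (norm (y - x0))\<^sup>2"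

text \<open>The query points \<open>p\<close> enter the model only through a sum that does not
  involve \<open>y\<close>. The minimizers are therefore governed by the directions \<open>v\<close>
  alone, which makes actual and virtual iterates comparable.\<close>

lemma da_model_eq_potential:
  assumes "proper_closed_convex \<psi>" "y \<in> effective_dom \<psi>"
  shows "da_model f \<psi> a \<gamma> x0 p v t y = ereal (da_potential (\<lambda>y. real_of_ereal (\<psi> y)) a \<gamma> x0 v (Suc t) y
    + (\<Sum>k\<le>t. a k * (f (p k) - v k \<bullet> p k)))"
proof -
  obtain r where r: "\<psi> y = ereal r"
    using proper_real_of_ereal[OF assms] by blast
  show ?thesis
    by (simp add: da_model_def da_potential_def r inner_sum_left lessThan_Suc_atMost
        algebra_simps sum.distrib sum_subtractf sum_distrib_right sum_distrib_left inner_diff_right)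
qed

text \<open>The potential is a convex function plus the quadratic with weight
  \<open>\<gamma> (t - 1)\<close>, so a minimizer beats every competitor by the corresponding
  quadratic gap. This inequality is the only way in which optimality of the iterates is used
  later.\<close>

lemma da_iterates_strong_min:
  assumes psi: "proper_closed_convex \<psi>" and x0: "x0 \<in> effective_dom \<psi>"
    and a: "\<And>t. a t > 0" and \<gamma>: "\<And>t. \<gamma> t > 0"
    and z: "da_iterates f \<psi> a \<gamma> x0 p v z"
  shows "z t \<in> effective_dom \<psi>"
    and "y \<in> effective_dom \<psi> \<Longrightarrow>
      da_potential (\<lambda>y. real_of_ereal (\<psi> y)) a \<gamma> x0 v t (z t) + \<gamma> (t - 1) / 2 * (norm (y - z t))\<^sup>2
      \<le> da_potential (\<lambda>y. real_of_ereal (\<psi> y)) a \<gamma> x0 v t y"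
proof -
  let ?h = "\<lambda>y. real_of_ereal (\<psi> y)"
  have "z t \<in> effective_dom \<psi> \<and> (\<forall>y\<in>effective_dom \<psi>.
    da_potential ?h a \<gamma> x0 v t (z t) \<le> da_potential ?h a \<gamma> x0 v t y)"
  proof (cases t)
    case 0
    then show ?thesis
      using z x0 \<gamma>[of 0] by (simp add: da_iterates_def da_potential_def)
  next
    case (Suc n)
    have "is_arg_min (da_model f \<psi> a \<gamma> x0 p v n) (\<lambda>y. y \<in> effective_dom \<psi>) (z (Suc n))"
      using z by (simp add: da_iterates_def)
    then have "z (Suc n) \<in> effective_dom \<psi>" "\<forall>y\<in>effective_dom \<psi>.
        da_model f \<psi> a \<gamma> x0 p v n (z (Suc n)) \<le> da_model f \<psi> a \<gamma> x0 p v n y"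
      by (auto simp: is_arg_min_linorder)
    then show ?thesis
      using da_model_eq_potential[OF psi] Suc by simp
  qed
 then have zt: "z t \<in> effective_dom \<psi>"
    and min: "\<And>y. y \<in> effective_dom \<psi> \<Longrightarrow> da_potential ?h a \<gamma> x0 v t (z t) \<le> da_potential ?h a \<gamma> x0 v t y"
    by auto
  show "z t \<in> effective_dom \<psi>" by (rule zt)
  assume y: "y \<in> effective_dom \<psi>"
  have h: "convex_on (effective_dom \<psi>) ?h"
    by (rule convex_on_real_of_ereal[OF psi])
  have "convex_on (effective_dom \<psi>) (\<lambda>y. (\<Sum>k<t. a k *\<^sub>R v k) \<bullet> y + (\<Sum>k<t. a k) * ?h y)"
  proof (rule convex_on_add)
    show "convex_on (effective_dom \<psi>) ((\<bullet>) (\<Sum>k<t. a k *\<^sub>R v k))"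
      using h by (auto simp: convex_on_def inner_simps)
    show "convex_on (effective_dom \<psi>) (\<lambda>y. (\<Sum>k<t. a k) * ?h y)"
      using a by (intro convex_on_cmul h sum_nonneg) (simp add: less_imp_le)
  qed
  from strongly_convex_minimizer[OF this zt y, of "\<gamma> (t - 1)" x0] min \<gamma>[of "t - 1"]
  show "da_potential ?h a \<gamma> x0 v t (z t) + \<gamma> (t - 1) / 2 * (norm (y - z t))\<^sup>2
      \<le> da_potential ?h a \<gamma> x0 v t y"
    by (simp add: da_potential_def)
qed

text \<open>Each minimizer is tested as a competitor in the potential of the other. On adding the
  two inequalities the terms in \<psi> and the regularizers cancel, and only the difference of the
  accumulated directions remains, to be bounded by Cauchy-Schwarz.\<close>

lemma da_iterates_lipschitz:
  assumes psi: "proper_closed_convex \<psi>" and x0: "x0 \<in> effective_dom \<psi>"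
    and a: "\<And>t. a t > 0" and \<gamma>: "\<And>t. \<gamma> t > 0"
    and z: "da_iterates f \<psi> a \<gamma> x0 p v z" and z': "da_iterates f \<psi> a \<gamma> x0 p' v' z'"
  shows "norm (z t - z' t) \<le> norm ((\<Sum>k<t. a k *\<^sub>R v k) - (\<Sum>k<t. a k *\<^sub>R v' k)) / \<gamma> (t - 1)"
proof -
  note d = da_iterates_strong_min[OF psi x0 a \<gamma>]
  define s where "s = (\<Sum>k<t. a k *\<^sub>R v k)"
  define s' where "s' = (\<Sum>k<t. a k *\<^sub>R v' k)"
  have "\<gamma> (t - 1) * (norm (z t - z' t))\<^sup>2 \<le> (s - s') \<bullet> (z' t - z t)"
    using d(2)[OF z d(1)[OF z', of t], of t] d(2)[OF z' d(1)[OF z, of t], of t]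
    by (simp add: da_potential_def flip: s_def s'_def)
      (simp add: algebra_simps inner_simps norm_minus_commute)
  also have "\<dots> \<le> norm (s - s') * norm (z t - z' t)"
    by (metis norm_cauchy_schwarz norm_minus_commute)
  finally have "norm (z t - z' t) * (\<gamma> (t - 1) * norm (z t - z' t)) \<le> norm (z t - z' t) * norm (s - s')"
    by (simp add: power2_eq_square mult_ac)
  then have "\<gamma> (t - 1) * norm (z t - z' t) \<le> norm (s - s')"
    by (cases "z t = z' t") (simp_all)
  then show ?thesis
    using \<gamma>[of "t - 1"] by (simp add: s_def s'_def le_divide_eq mult.commute)
qed

section \<open>Regret and descent inequalities from consecutive potentials\<close>

lemma da_potential_Suc:
  "da_potential h a \<gamma> x0 v (Suc t) y = da_potential h a \<gamma> x0 v t y + a t * (v t \<bullet> y + h y)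
    + (\<gamma> t - \<gamma> (t - 1)) / 2 * (norm (y - x0))\<^sup>2"
  by (simp add: da_potential_def inner_simps algebra_simps diff_divide_distrib)

text \<open>The minimal value of the potential dominates the accumulated losses and squared steps,
  while the potential at \<open>x\<close> dominates this minimal value with a quadratic gap. That
  gap is the distance term on the left.\<close>

lemma da_iterates_regret:
  assumes psi: "proper_closed_convex \<psi>" and x0: "x0 \<in> effective_dom \<psi>"
    and a: "\<And>t. a t > 0" and \<gamma>: "\<And>t. \<gamma> t > 0" and mono: "incseq \<gamma>"
    and z: "da_iterates f \<psi> a \<gamma> x0 p v z" and x: "x \<in> effective_dom \<psi>"
  shows "(\<Sum>t<T. a t * (v t \<bullet> (z (Suc t) - x) + real_of_ereal (\<psi> (z (Suc t))) - real_of_ereal (\<psi> x))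
      + \<gamma> (t - 1) / 2 * (norm (z (Suc t) - z t))\<^sup>2) + \<gamma> (T - 1) / 2 * (norm (x - z T))\<^sup>2
    \<le> \<gamma> (T - 1) / 2 * (norm (x - x0))\<^sup>2"
proof -
  let ?h = "\<lambda>y. real_of_ereal (\<psi> y)"
  let ?\<Phi> = "da_potential ?h a \<gamma> x0 v"
  note d = da_iterates_strong_min[OF psi x0 a \<gamma> z]
  \<comment> \<open>In the induction, strong minimality of \<open>z T\<close> against
    \<open>z (Suc T)\<close> produces the squared step, and the change of regularizer is dropped
    because \<gamma> is non-decreasing.\<close>
  have "(\<Sum>t<T. a t * (v t \<bullet> z (Suc t) + ?h (z (Suc t))) + \<gamma> (t - 1) / 2 * (norm (z (Suc t) - z t))\<^sup>2)
      \<le> ?\<Phi> T (z T)"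
  proof (induction T)
    case 0
    then show ?case
      using z by (simp add: da_potential_def da_iterates_def)
  next
    case (Suc T)
    have "0 \<le> (\<gamma> T - \<gamma> (T - 1)) / 2 * (norm (z (Suc T) - x0))\<^sup>2"
      using incseqD[OF mono, of "T - 1" T] by simp
    then show ?case
      using Suc d(2)[OF d(1)[of "Suc T"], of T] by (simp add: da_potential_Suc)
  qed
  moreover have "?\<Phi> T x = (\<Sum>t<T. a t * (v t \<bullet> x + ?h x)) + \<gamma> (T - 1) / 2 * (norm (x - x0))\<^sup>2"
    by (simp add: da_potential_def inner_sum_left sum_distrib_right sum_distrib_left sum.distrib algebra_simps)
  moreover have "?\<Phi> T (z T) + \<gamma> (T - 1) / 2 * (norm (x - z T))\<^sup>2 \<le> ?\<Phi> T x"
    by (rule d(2)[OF x])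
  moreover have "(\<Sum>t<T. a t * (v t \<bullet> (z (Suc t) - x) + ?h (z (Suc t)) - ?h x)
      + \<gamma> (t - 1) / 2 * (norm (z (Suc t) - z t))\<^sup>2)
    = (\<Sum>t<T. a t * (v t \<bullet> z (Suc t) + ?h (z (Suc t))) + \<gamma> (t - 1) / 2 * (norm (z (Suc t) - z t))\<^sup>2)
      - (\<Sum>t<T. a t * (v t \<bullet> x + ?h x))"
    unfolding sum_subtractf[symmetric] by (intro sum.cong refl) (simp add: algebra_simps inner_simps)
  ultimately show ?thesis
    by linarith
qed

text \<open>Here \<open>u\<close> plays the estimates, \<open>v\<close> the stochastic gradients,
  \<open>p\<close> the actual and \<open>z\<close> the virtual iterates. The regret bound supplies
  half of \<open>\<gamma> (t - 1)\<close> times the squared step, spent in two equal parts: one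
  absorbs the smoothness error, the other the noise acting on the step. The noise against
  \<open>z t - x\<close> is kept exactly, since it will have mean zero.\<close>

lemma da_iterates_virtual_regret:
  fixes f :: "'a::euclidean_space \<Rightarrow> real"
  assumes psi: "proper_closed_convex \<psi>" and f: "convex_on (effective_dom \<psi>) f"
    and grad: "\<And>y. y \<in> effective_dom \<psi> \<Longrightarrow> GDERIV f y :> grad y"
    and smooth: "L-lipschitz_on (effective_dom \<psi>) grad"
    and x0: "x0 \<in> effective_dom \<psi>" and a: "\<And>t. a t > 0" and \<gamma>: "\<And>t. \<gamma> t > 0"
    and mono: "incseq \<gamma>" and ge: "\<And>t. \<gamma> (t - 1) \<ge> 4 * a t * L"
    and p: "da_iterates f \<psi> a \<gamma> x0 p u p" and z: "da_iterates f \<psi> a \<gamma> x0 p v z"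
    and x: "x \<in> effective_dom \<psi>"
  defines "F \<equiv> \<lambda>y. f y + real_of_ereal (\<psi> y)"
  shows "(\<Sum>t<T. a t * (F (z (Suc t)) - F x)) + \<gamma> (T - 1) / 2 * (norm (x - z T))\<^sup>2
    \<le> \<gamma> (T - 1) / 2 * (norm (x - x0))\<^sup>2
      + L * (\<Sum>t<T. a t / (\<gamma> (t - 1))\<^sup>2 * (norm (accumulated_error a u v t))\<^sup>2)
      + (\<Sum>t<T. (a t)\<^sup>2 / \<gamma> (t - 1) * (norm (v t - grad (p t)))\<^sup>2)
      - (\<Sum>t<T. a t * ((v t - grad (p t)) \<bullet> (z t - x)))"
proof -
  let ?h = "\<lambda>y. real_of_ereal (\<psi> y)"
  have S: "convex (effective_dom \<psi>)"
    using f by (simp add: convex_on_def)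
  have L: "L \<ge> 0"
    by (rule lipschitz_on_nonneg[OF smooth])
  have step: "a t * (F (z (Suc t)) - F x)
      \<le> a t * (v t \<bullet> (z (Suc t) - x) + ?h (z (Suc t)) - ?h x) + \<gamma> (t - 1) / 2 * (norm (z (Suc t) - z t))\<^sup>2
        + L * (a t / (\<gamma> (t - 1))\<^sup>2 * (norm (accumulated_error a u v t))\<^sup>2)
        + (a t)\<^sup>2 / \<gamma> (t - 1) * (norm (v t - grad (p t)))\<^sup>2 - a t * ((v t - grad (p t)) \<bullet> (z t - x))" for t
  proof -
    define \<delta> where "\<delta> = v t - grad (p t)"
    define d where "d = z (Suc t) - z t"
    define c where "c = \<gamma> (t - 1)"
    have pos: "a t > 0" "c > 0"
      using a \<gamma> by (auto simp: c_def)
    note dom = da_iterates_strong_min(1)[OF psi x0 a \<gamma> p, of t]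
      da_iterates_strong_min(1)[OF psi x0 a \<gamma> z, of "Suc t"]
    have "f (z (Suc t)) - f x \<le> grad (p t) \<bullet> (z (Suc t) - x) + L / 2 * (norm (z (Suc t) - p t))\<^sup>2"
      using lipschitz_gradient_descent[OF S dom grad smooth] convex_on_above_gradient[OF f dom(1) x grad[OF dom(1)]]
      by (simp add: inner_simps)
    \<comment> \<open>The noise is split at \<open>z t\<close>, which does not depend on the current
      sample, unlike \<open>z (Suc t)\<close>.\<close>
    also have "grad (p t) \<bullet> (z (Suc t) - x) = v t \<bullet> (z (Suc t) - x) - \<delta> \<bullet> d - \<delta> \<bullet> (z t - x)"
      by (simp add: \<delta>_def d_def inner_simps)
    finally have "a t * (f (z (Suc t)) - f x)
        \<le> a t * (v t \<bullet> (z (Suc t) - x) - \<delta> \<bullet> d - \<delta> \<bullet> (z t - x) + L / 2 * (norm (z (Suc t) - p t))\<^sup>2)"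
      using pos by (intro mult_left_mono) auto
    moreover have "a t * (L / 2 * (norm (z (Suc t) - p t))\<^sup>2)
        \<le> c / 4 * (norm d)\<^sup>2 + L * (a t / c\<^sup>2 * (norm (accumulated_error a u v t))\<^sup>2)"
    proof -
      have "norm (p t - z t) \<le> norm (accumulated_error a u v t) / c"
        using da_iterates_lipschitz[OF psi x0 a \<gamma> p z, of t]
        by (simp add: accumulated_error_def c_def scaleR_diff_right sum_subtractf)
      from power_mono[OF this norm_ge_zero, of 2]
      have e: "(norm (p t - z t))\<^sup>2 \<le> (norm (accumulated_error a u v t))\<^sup>2 / c\<^sup>2"
        by (simp add: power_divide)
      \<comment> \<open>Parallelogram identity: the missing term is the squared norm of
        \<open>d + (p t - z t)\<close>.\<close>
      have "(norm (z (Suc t) - p t))\<^sup>2 \<le> 2 * (norm d)\<^sup>2 + 2 * (norm (p t - z t))\<^sup>2"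
        using zero_le_power2[of "norm (d + (p t - z t))"]
        by (simp add: d_def power2_norm_eq_inner inner_simps inner_commute)
      also have "\<dots> \<le> 2 * (norm d)\<^sup>2 + 2 * ((norm (accumulated_error a u v t))\<^sup>2 / c\<^sup>2)"
        using e by simp
      finally have "a t * (L / 2 * (norm (z (Suc t) - p t))\<^sup>2)
          \<le> a t * (L / 2 * (2 * (norm d)\<^sup>2 + 2 * ((norm (accumulated_error a u v t))\<^sup>2 / c\<^sup>2)))"
        using pos L by (intro mult_left_mono) auto
      also have "\<dots> = a t * L * (norm d)\<^sup>2 + L * (a t / c\<^sup>2 * (norm (accumulated_error a u v t))\<^sup>2)"
        by (simp add: algebra_simps)
      \<comment> \<open>This is where the factor 4 in the condition on \<gamma> is spent.\<close>
      also have "a t * L * (norm d)\<^sup>2 \<le> c / 4 * (norm d)\<^sup>2"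
        using ge[of t] by (intro mult_right_mono) (auto simp: c_def)
      finally show ?thesis by simp
    qed
    moreover have "0 \<le> a t * (\<delta> \<bullet> d) + c / 4 * (norm d)\<^sup>2 + (a t)\<^sup>2 / c * (norm \<delta>)\<^sup>2"
    proof -
      \<comment> \<open>Young's inequality by completing the square, weighted so that the squared
        step gets exactly the remaining quarter of \<open>c\<close>.\<close>
      have "0 \<le> (norm ((c / 2) *\<^sub>R d + a t *\<^sub>R \<delta>))\<^sup>2 / c"
        using pos by simp
      also have "\<dots> = a t * (\<delta> \<bullet> d) + c / 4 * (norm d)\<^sup>2 + (a t)\<^sup>2 / c * (norm \<delta>)\<^sup>2"
        using pos unfolding power2_norm_eq_inner
        by (simp add: inner_simps inner_commute power2_eq_square field_simps)
      finally show ?thesis .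
    qed
    moreover have "a t * (F (z (Suc t)) - F x) = a t * (f (z (Suc t)) - f x) + a t * (?h (z (Suc t)) - ?h x)"
      by (simp add: F_def algebra_simps)
    ultimately show ?thesis
      unfolding \<delta>_def[symmetric] d_def[symmetric] c_def[symmetric] by (simp add: algebra_simps)
  qed
  show ?thesis
    using sum_mono[of "{..<T}" "\<lambda>t. a t * (F (z (Suc t)) - F x)", OF step]
      da_iterates_regret[OF psi x0 a \<gamma> mono z x, of T]
    unfolding sum.distrib sum_subtractf sum_distrib_left[symmetric] by linarith
qed

text \<open>Strong minimality of the potentials \<open>t\<close> and \<open>Suc t\<close>, each
  tested at the other's minimizer, yields the two weights \<open>\<gamma> t\<close> and
  \<open>\<gamma> (t - 1)\<close> on the same squared step. After division by \<open>a t\<close>,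
  the descent lemma replaces the linear term by the decrease of \<open>F\<close>, which
  telescopes.\<close>

lemma da_iterates_descent:
  assumes psi: "proper_closed_convex \<psi>"
    and grad: "\<And>y. y \<in> effective_dom \<psi> \<Longrightarrow> GDERIV f y :> grad y"
    and smooth: "L-lipschitz_on (effective_dom \<psi>) grad"
    and x0: "x0 \<in> effective_dom \<psi>" and a: "\<And>t. a t > 0" and \<gamma>: "\<And>t. \<gamma> t > 0"
    and z: "da_iterates f \<psi> a \<gamma> x0 z v z"
  defines "F \<equiv> \<lambda>y. f y + real_of_ereal (\<psi> y)"
  shows "(\<Sum>t<T. (\<gamma> t + \<gamma> (t - 1) - a t * L) / (2 * a t) * (norm (z (Suc t) - z t))\<^sup>2
        + (v t - grad (z t)) \<bullet> (z (Suc t) - z t))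
    \<le> F x0 - F (z T) + 1 / 2 * (\<Sum>t<T. (\<gamma> t - \<gamma> (t - 1)) / a t * (norm (z t - x0))\<^sup>2
        - (\<gamma> t - \<gamma> (t - 1)) / a t * (norm (z (Suc t) - x0))\<^sup>2)"
proof -
  let ?h = "\<lambda>y. real_of_ereal (\<psi> y)"
  have S: "convex (effective_dom \<psi>)"
    using convex_on_real_of_ereal[OF psi] by (simp add: convex_on_def)
  have step: "(\<gamma> t + \<gamma> (t - 1) - a t * L) / (2 * a t) * (norm (z (Suc t) - z t))\<^sup>2
        + (v t - grad (z t)) \<bullet> (z (Suc t) - z t)
      \<le> F (z t) - F (z (Suc t)) + 1 / 2 * ((\<gamma> t - \<gamma> (t - 1)) / a t * (norm (z t - x0))\<^sup>2
        - (\<gamma> t - \<gamma> (t - 1)) / a t * (norm (z (Suc t) - x0))\<^sup>2)" for t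
  proof -
    note d = da_iterates_strong_min[OF psi x0 a \<gamma> z]
    define q where "q = (norm (z (Suc t) - z t))\<^sup>2"
    \<comment> \<open>The contribution of the changing regularizer; division by \<open>a t\<close>
      turns it into the terms with the coefficient called \<beta> in the theorem.\<close>
    define \<Delta> where "\<Delta> = (\<gamma> t - \<gamma> (t - 1)) / 2 * ((norm (z t - x0))\<^sup>2 - (norm (z (Suc t) - x0))\<^sup>2)"
    have "a t * (v t \<bullet> (z (Suc t) - z t) + ?h (z (Suc t)) - ?h (z t)) + (\<gamma> t + \<gamma> (t - 1)) / 2 * q \<le> \<Delta>"
      using d(2)[OF d(1)[of t], of "Suc t"] d(2)[OF d(1)[of "Suc t"], of t]
      by (simp add: da_potential_Suc q_def \<Delta>_def norm_minus_commute[of "z t"] algebra_simps inner_simps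
          add_divide_distrib diff_divide_distrib)
    then have "(a t * (v t \<bullet> (z (Suc t) - z t) + ?h (z (Suc t)) - ?h (z t)) + (\<gamma> t + \<gamma> (t - 1)) / 2 * q) / a t
        \<le> \<Delta> / a t"
      using a[of t] by (intro divide_right_mono) auto
    also have "(a t * (v t \<bullet> (z (Suc t) - z t) + ?h (z (Suc t)) - ?h (z t)) + (\<gamma> t + \<gamma> (t - 1)) / 2 * q) / a t
        = v t \<bullet> (z (Suc t) - z t) + ?h (z (Suc t)) - ?h (z t) + (\<gamma> t + \<gamma> (t - 1)) / (2 * a t) * q"
      using a[of t] by (simp add: field_simps)
    finally have "v t \<bullet> (z (Suc t) - z t) + ?h (z (Suc t)) - ?h (z t)
        + (\<gamma> t + \<gamma> (t - 1)) / (2 * a t) * q \<le> \<Delta> / a t" .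
    moreover have "\<Delta> / a t = 1 / 2 * ((\<gamma> t - \<gamma> (t - 1)) / a t * (norm (z t - x0))\<^sup>2
        - (\<gamma> t - \<gamma> (t - 1)) / a t * (norm (z (Suc t) - x0))\<^sup>2)"
      by (simp add: \<Delta>_def algebra_simps add_divide_distrib diff_divide_distrib)
    moreover have "(\<gamma> t + \<gamma> (t - 1) - a t * L) / (2 * a t) * q = (\<gamma> t + \<gamma> (t - 1)) / (2 * a t) * q - L / 2 * q"
      using a[of t] by (simp add: field_simps)
    moreover have "f (z (Suc t)) \<le> f (z t) + grad (z t) \<bullet> (z (Suc t) - z t) + L / 2 * q"
      unfolding q_def by (rule lipschitz_gradient_descent[OF S d(1) d(1) grad smooth])
    ultimately show ?thesis
      unfolding q_def[symmetric] F_def by (simp only: inner_diff_left)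
  qed
  have "(\<Sum>t<T. F (z t) - F (z (Suc t))) = F x0 - F (z T)"
    using z by (simp add: sum_lessThan_telescope'[of "\<lambda>t. F (z t)"] da_iterates_def)
  then show ?thesis
    using sum_mono[of "{..<T}" "\<lambda>t. (\<gamma> t + \<gamma> (t - 1) - a t * L) / (2 * a t) * (norm (z (Suc t) - z t))\<^sup>2
        + (v t - grad (z t)) \<bullet> (z (Suc t) - z t)", OF step]
    unfolding sum.distrib sum_distrib_left[symmetric] by linarith
qed


section \<open>Measurability and moments\<close>

text \<open>Preimages under \<open>Z\<close> belong to the past \<open>P\<close> and preimages under
  \<xi> to the sigma-algebra of the fresh sample, so the joint law factors on rectangles, which
  determine it.\<close>

lemma (in prob_space) distr_pair_fresh:
  assumes fresh: "indep_set (sets (vimage_algebra (space M) \<xi> D)) (sets P)"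
    and \<xi>: "\<xi> \<in> measurable M D" and P: "space P = space M" and Z: "Z \<in> measurable P N"
  shows "distr M (N \<Otimes>\<^sub>M D) (\<lambda>\<omega>. (Z \<omega>, \<xi> \<omega>)) = distr M N Z \<Otimes>\<^sub>M distr M D \<xi>"
proof -
  have ind: "sets P \<subseteq> events" "\<And>A B. A \<in> sets (vimage_algebra (space M) \<xi> D) \<Longrightarrow> B \<in> sets P \<Longrightarrow>
      prob (A \<inter> B) = prob A * prob B"
    using fresh by (auto simp: indep_sets2_eq)
  have ZM: "Z \<in> measurable M N"
    using Z ind(1) P by (auto simp: measurable_def)
  have pair: "(\<lambda>\<omega>. (Z \<omega>, \<xi> \<omega>)) \<in> measurable M (N \<Otimes>\<^sub>M D)"
    using ZM \<xi> by simp
  interpret Z: prob_space "distr M N Z"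
    by (rule prob_space_distr[OF ZM])
  interpret \<xi>: prob_space "distr M D \<xi>"
    by (rule prob_space_distr[OF \<xi>])
  show ?thesis
  proof (rule pair_measure_eqI[symmetric])
    fix A B assume AB: "A \<in> sets (distr M N Z)" "B \<in> sets (distr M D \<xi>)"
    have "Z -` A \<inter> space M \<in> sets P" "\<xi> -` B \<inter> space M \<in> sets (vimage_algebra (space M) \<xi> D)"
      using AB Z P by (auto simp: measurable_def intro: in_vimage_algebra)
    then have "prob (Z -` A \<inter> space M \<inter> (\<xi> -` B \<inter> space M)) = prob (Z -` A \<inter> space M) * prob (\<xi> -` B \<inter> space M)"
      using ind(2) by (simp add: Int_commute mult.commute)
    moreover have "(\<lambda>\<omega>. (Z \<omega>, \<xi> \<omega>)) -` (A \<times> B) \<inter> space M = Z -` A \<inter> space M \<inter> (\<xi> -` B \<inter> space M)"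
      by auto
    ultimately show "emeasure (distr M N Z) A * emeasure (distr M D \<xi>) B =
        emeasure (distr M (N \<Otimes>\<^sub>M D) (\<lambda>\<omega>. (Z \<omega>, \<xi> \<omega>))) (A \<times> B)"
      using AB ZM \<xi> pair by (simp add: emeasure_distr emeasure_eq_measure ennreal_mult)
  qed (unfold_locales, simp)
qed

text \<open>The domain of the minimizer map need not be measurable; it suffices that it factors through
  a continuous function on the range of the data.\<close>

lemma measurable_lipschitz_factor:
  fixes s :: "'w \<Rightarrow> 'a::{metric_space, second_countable_topology}"
    and z :: "'w \<Rightarrow> 'b::{metric_space, second_countable_topology}"
  assumes s: "s \<in> borel_measurable N"
    and lip: "\<And>\<omega> \<omega>'. \<omega> \<in> space N \<Longrightarrow> \<omega>' \<in> space N \<Longrightarrow> dist (z \<omega>) (z \<omega>') \<le> C * dist (s \<omega>) (s \<omega>')"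
  shows "z \<in> borel_measurable N"
proof -
  \<comment> \<open>Any choice of preimage works: outcomes with the same value of \<open>s\<close>
    are at distance 0 under \<open>z\<close> by the Lipschitz bound.\<close>
  define \<pi> where "\<pi> = (\<lambda>u. z (inv_into (space N) s u))"
  have "dist (\<pi> u) (\<pi> u') \<le> \<bar>C\<bar> * dist u u'" if "u \<in> s ` space N" "u' \<in> s ` space N" for u u'
  proof -
    have "dist (\<pi> u) (\<pi> u') \<le> C * dist u u'"
      using lip[OF inv_into_into[OF that(1)] inv_into_into[OF that(2)]] that
      by (simp add: \<pi>_def f_inv_into_f)
    also have "\<dots> \<le> \<bar>C\<bar> * dist u u'"
      by (intro mult_right_mono) auto
    finally show ?thesis .
  qed
  then have "\<bar>C\<bar>-lipschitz_on (s ` space N) \<pi>"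
    by (intro lipschitz_onI) auto
  then have "\<pi> \<in> borel_measurable (restrict_space borel (s ` space N))"
    by (intro borel_measurable_continuous_on_restrict lipschitz_on_continuous_on)
  moreover have "s \<in> measurable N (restrict_space borel (s ` space N))"
    using s by (intro measurable_restrict_space2) auto
  ultimately have "(\<lambda>\<omega>. \<pi> (s \<omega>)) \<in> borel_measurable N"
    by (rule measurable_compose[rotated])
  moreover have "\<pi> (s \<omega>) = z \<omega>" if "\<omega> \<in> space N" for \<omega>
  proof -
    have "s \<omega> \<in> s ` space N" using that by blast
    then show ?thesis
      using lip[OF inv_into_into that, of "s \<omega>" s] by (simp add: \<pi>_def f_inv_into_f)
  qed
  ultimately show ?thesis
    by (simp cong: measurable_cong)
qed

text \<open>The iterate depends on the outcome only through the accumulated direction, and does so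
  in a Lipschitz way. The sigma-algebra \<open>N\<close> is arbitrary so that the lemma serves both
  \<open>M\<close> and the past.\<close>

lemma da_iterates_measurable:
  assumes psi: "proper_closed_convex \<psi>" and x0: "x0 \<in> effective_dom \<psi>"
    and a: "\<And>t. a t > 0" and \<gamma>: "\<And>t. \<gamma> t > 0"
    and z: "\<And>\<omega>. \<omega> \<in> space N \<Longrightarrow>
      da_iterates f \<psi> a \<gamma> x0 (\<lambda>t. p t \<omega>) (\<lambda>t. v t \<omega>) (\<lambda>t. z t \<omega>)"
    and v: "\<And>k. k < t \<Longrightarrow> v k \<in> borel_measurable N"
  shows "z t \<in> measurable N (restrict_space borel (effective_dom \<psi>))"
proof (rule measurable_restrict_space2)
  show "z t \<in> space N \<rightarrow> effective_dom \<psi>"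
    using da_iterates_strong_min(1)[OF psi x0 a \<gamma> z] by auto
  have [measurable]: "(\<lambda>\<omega>. \<Sum>k<t. a k *\<^sub>R v k \<omega>) \<in> borel_measurable N"
    using v by (intro borel_measurable_sum borel_measurable_scaleR) auto
  show "z t \<in> borel_measurable N"
  proof (rule measurable_lipschitz_factor)
    fix \<omega> \<omega>' assume "\<omega> \<in> space N" "\<omega>' \<in> space N"
    from da_iterates_lipschitz[OF psi x0 a \<gamma> z[OF this(1)] z[OF this(2)], of t]
    show "dist (z t \<omega>) (z t \<omega>') \<le>
        1 / \<gamma> (t - 1) * dist (\<Sum>k<t. a k *\<^sub>R v k \<omega>) (\<Sum>k<t. a k *\<^sub>R v k \<omega>')"
      by (simp add: dist_norm)
  qed measurable
qed

section \<open>The sigma-algebra of the past\<close>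

lemma space_past [simp]: "space (past M D \<xi> ghat t) = space M"
  by (simp add: past_def)

lemma measurable_past:
  assumes \<xi>: "\<And>k. \<xi> k \<in> measurable M D" and ghat: "\<And>k. ghat k \<in> borel_measurable M" and k: "k < t"
  shows "\<xi> k \<in> measurable (past M D \<xi> ghat t) D" and "ghat k \<in> borel_measurable (past M D \<xi> ghat t)"
proof -
  have "(\<lambda>\<omega>. \<lambda>k\<in>{..<t}. (\<xi> k \<omega>, ghat k \<omega>)) \<in> measurable (past M D \<xi> ghat t) (Pi\<^sub>M {..<t} (\<lambda>_. D \<Otimes>\<^sub>M borel))"
    unfolding past_def
    by (rule measurable_vimage_algebra1)
      (use measurable_space[OF \<xi>] in \<open>auto simp: space_PiM space_pair_measure\<close>)
  from measurable_compose[OF this measurable_component_singleton[of k]]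
  have pair: "(\<lambda>\<omega>. (\<xi> k \<omega>, ghat k \<omega>)) \<in> measurable (past M D \<xi> ghat t) (D \<Otimes>\<^sub>M borel)"
    using k by simp
  show "\<xi> k \<in> measurable (past M D \<xi> ghat t) D" "ghat k \<in> borel_measurable (past M D \<xi> ghat t)"
    using measurable_compose[OF pair measurable_fst] measurable_compose[OF pair measurable_snd] by simp_all
qed

section \<open>Square integrable random vectors\<close>

definition square_integrable :: "'w measure \<Rightarrow> ('w \<Rightarrow> 'a::euclidean_space) \<Rightarrow> bool"
  where "square_integrable M Y \<longleftrightarrow>
    Y \<in> borel_measurable M \<and> integrable M (\<lambda>\<omega>. (norm (Y \<omega>))\<^sup>2)"

lemma square_integrable_dominated:
  assumes Y: "Y \<in> borel_measurable M" and Z: "square_integrable M Z"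
    and le: "\<And>\<omega>. \<omega> \<in> space M \<Longrightarrow> norm (Y \<omega>) \<le> c * norm (Z \<omega>)"
  shows "square_integrable M Y"
  unfolding square_integrable_def
proof (intro conjI Y)
  have "integrable M (\<lambda>\<omega>. c\<^sup>2 * (norm (Z \<omega>))\<^sup>2)"
    using Z by (simp add: square_integrable_def)
  then show "integrable M (\<lambda>\<omega>. (norm (Y \<omega>))\<^sup>2)"
  proof (rule Bochner_Integration.integrable_bound)
    show "(\<lambda>\<omega>. (norm (Y \<omega>))\<^sup>2) \<in> borel_measurable M"
      using Y by measurable
    show "AE \<omega> in M. norm ((norm (Y \<omega>))\<^sup>2) \<le> norm (c\<^sup>2 * (norm (Z \<omega>))\<^sup>2)"
      using power_mono[OF le norm_ge_zero, of _ 2] by (intro AE_I2) (simp add: power_mult_distrib)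
  qed
qed

lemma square_integrable_add:
  assumes "square_integrable M Y" "square_integrable M Z"
  shows "square_integrable M (\<lambda>\<omega>. Y \<omega> + Z \<omega>)"
proof -
  have [measurable]: "Y \<in> borel_measurable M" "Z \<in> borel_measurable M"
    using assms by (auto simp: square_integrable_def)
  have "integrable M (\<lambda>\<omega>. 2 * (norm (Y \<omega>))\<^sup>2 + 2 * (norm (Z \<omega>))\<^sup>2)"
    using assms by (simp add: square_integrable_def)
  then have "integrable M (\<lambda>\<omega>. (norm (Y \<omega> + Z \<omega>))\<^sup>2)"
  proof (rule Bochner_Integration.integrable_bound)
    have "(norm (u + w))\<^sup>2 \<le> 2 * (norm u)\<^sup>2 + 2 * (norm w)\<^sup>2" for u w :: 'b
      using zero_le_power2[of "norm (u - w)"]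
      by (simp add: power2_norm_eq_inner inner_simps inner_commute)
    then show "AE \<omega> in M. norm ((norm (Y \<omega> + Z \<omega>))\<^sup>2) \<le> norm (2 * (norm (Y \<omega>))\<^sup>2 + 2 * (norm (Z \<omega>))\<^sup>2)"
      by simp
  qed measurable
  then show ?thesis
    by (simp add: square_integrable_def)
qed

lemma square_integrable_scaleR:
  assumes "square_integrable M Y"
  shows "square_integrable M (\<lambda>\<omega>. c *\<^sub>R Y \<omega>)"
  using assms by (auto simp: square_integrable_def power_mult_distrib)

lemma (in finite_measure) square_integrable_const: "square_integrable M (\<lambda>_. c)"
  by (simp add: square_integrable_def)

lemma (in finite_measure) square_integrable_sum:
  assumes "\<And>i. i \<in> I \<Longrightarrow> square_integrable M (Y i)"
  shows "square_integrable M (\<lambda>\<omega>. \<Sum>i\<in>I. Y i \<omega>)"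
  using assms
  by (induction I rule: infinite_finite_induct) (auto intro: square_integrable_add square_integrable_const)

lemma square_integrable_inner:
  assumes "square_integrable M Y" "square_integrable M Z"
  shows "integrable M (\<lambda>\<omega>. Y \<omega> \<bullet> Z \<omega>)"
proof -
  have [measurable]: "Y \<in> borel_measurable M" "Z \<in> borel_measurable M"
    using assms by (auto simp: square_integrable_def)
  have "integrable M (\<lambda>\<omega>. (norm (Y \<omega>))\<^sup>2 + (norm (Z \<omega>))\<^sup>2)"
    using assms by (simp add: square_integrable_def)
  then show ?thesis
  proof (rule Bochner_Integration.integrable_bound)
    have "\<bar>u \<bullet> w\<bar> \<le> (norm u)\<^sup>2 + (norm w)\<^sup>2" for u w :: 'b
      using Cauchy_Schwarz_ineq2[of u w] sum_squares_bound[of "norm u" "norm w"]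
        mult_nonneg_nonneg[of "norm u" "norm w"] by simp
    then show "AE \<omega> in M. norm (Y \<omega> \<bullet> Z \<omega>) \<le> norm ((norm (Y \<omega>))\<^sup>2 + (norm (Z \<omega>))\<^sup>2)"
      by simp
  qed measurable
qed

text \<open>Independence turns the joint law of past data and fresh sample into a product, so by
  Fubini the sample is integrated first, with the query point frozen. The pointwise oracle
  assumptions then give the second moment bound and orthogonality of the noise to everything
  past.\<close>

lemma (in prob_space) noise_moments:
  fixes g :: "'b::euclidean_space \<Rightarrow> 's \<Rightarrow> 'b" and grad :: "'b \<Rightarrow> 'b"
  assumes g: "(\<lambda>(y, s). g y s) \<in> borel_measurable (restrict_space borel S \<Otimes>\<^sub>M D)"
    and grad: "grad \<in> borel_measurable (restrict_space borel S)"
    and unbiased: "\<And>y. y \<in> S \<Longrightarrow> integrable D (g y) \<and> (\<integral>s. g y s \<partial>D) = grad y"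
    and variance: "\<And>y. y \<in> S \<Longrightarrow> (\<integral>\<^sup>+ s. ennreal ((norm (g y s - grad y))\<^sup>2) \<partial>D) \<le> ennreal (\<sigma>\<^sup>2)"
    and fresh: "indep_set (sets (vimage_algebra (space M) \<xi> D)) (sets P)"
    and \<xi>: "\<xi> \<in> measurable M D" "distr M D \<xi> = D" and P: "space P = space M"
    and X: "X \<in> measurable P (restrict_space borel S)"
  shows "square_integrable M (\<lambda>\<omega>. g (X \<omega>) (\<xi> \<omega>) - grad (X \<omega>))"
    and "(\<integral>\<omega>. (norm (g (X \<omega>) (\<xi> \<omega>) - grad (X \<omega>)))\<^sup>2 \<partial>M) \<le> \<sigma>\<^sup>2"
    and "V \<in> borel_measurable P \<Longrightarrow> square_integrable M V \<Longrightarrow>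
      (\<integral>\<omega>. (g (X \<omega>) (\<xi> \<omega>) - grad (X \<omega>)) \<bullet> V \<omega> \<partial>M) = 0"
proof -
  let ?R = "restrict_space borel S"
  let ?\<delta> = "\<lambda>\<omega>. g (X \<omega>) (\<xi> \<omega>) - grad (X \<omega>)"
  note [measurable] = g grad \<xi>(1)
  have "sets P \<subseteq> events"
    using fresh by (auto simp: indep_sets2_eq)
  then have XM [measurable]: "X \<in> measurable M ?R"
    using X P by (auto simp: measurable_def)
  interpret D: prob_space D
    using prob_space_distr[OF \<xi>(1)] by (simp add: \<xi>(2))
  have \<delta> [measurable]: "(\<lambda>(y, s). g y s - grad y) \<in> borel_measurable (?R \<Otimes>\<^sub>M D)"
    using measurable_compose[OF measurable_fst grad] g by (simp add: split_beta')
  have \<delta>M [measurable]: "?\<delta> \<in> borel_measurable M"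
    using measurable_compose[OF measurable_Pair[OF XM \<xi>(1)] \<delta>] by simp
  have S: "space ?R = S"
    by (simp add: space_restrict_space)
  define \<eta> where "\<eta> = (\<lambda>q. ennreal ((norm (g (fst q) (snd q) - grad (fst q)))\<^sup>2))"
  have \<eta>: "\<eta> \<in> borel_measurable (?R \<Otimes>\<^sub>M D)"
    unfolding \<eta>_def using \<delta>
    by (intro measurable_compose[OF _ measurable_ennreal] borel_measurable_power borel_measurable_norm)
      (simp add: split_beta')
  have "(\<integral>\<^sup>+ \<omega>. ennreal ((norm (?\<delta> \<omega>))\<^sup>2) \<partial>M) = (\<integral>\<^sup>+ q. \<eta> q \<partial>distr M (?R \<Otimes>\<^sub>M D) (\<lambda>\<omega>. (X \<omega>, \<xi> \<omega>)))"
    using \<eta> by (subst nn_integral_distr[OF measurable_Pair[OF XM \<xi>(1)]]) (simp_all add: \<eta>_def)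
  also have "\<dots> = (\<integral>\<^sup>+ y. (\<integral>\<^sup>+ s. \<eta> (y, s) \<partial>D) \<partial>distr M ?R X)"
    unfolding distr_pair_fresh[OF fresh \<xi>(1) P X] \<xi>(2)
    using \<eta> by (intro D.nn_integral_fst[symmetric]) (simp cong: measurable_cong_sets)
  also have "\<dots> \<le> (\<integral>\<^sup>+ y. ennreal (\<sigma>\<^sup>2) \<partial>distr M ?R X)"
    by (rule nn_integral_mono) (use variance S in \<open>auto simp: \<eta>_def\<close>)
  also have "\<dots> = ennreal (\<sigma>\<^sup>2)"
    using prob_space.emeasure_space_1[OF prob_space_distr[OF XM]] by simp
  finally have bound: "(\<integral>\<^sup>+ \<omega>. ennreal ((norm (?\<delta> \<omega>))\<^sup>2) \<partial>M) \<le> ennreal (\<sigma>\<^sup>2)" .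
  from le_less_trans[OF this ennreal_less_top]
  have int: "integrable M (\<lambda>\<omega>. (norm (?\<delta> \<omega>))\<^sup>2)"
    by (simp add: integrable_iff_bounded)
  then show sq: "square_integrable M ?\<delta>"
    by (simp add: square_integrable_def)
  show "(\<integral>\<omega>. (norm (?\<delta> \<omega>))\<^sup>2 \<partial>M) \<le> \<sigma>\<^sup>2"
    using bound nn_integral_eq_integral[OF int] by simp
  assume V: "V \<in> borel_measurable P" "square_integrable M V"
  \<comment> \<open>The query point and the test vector are frozen jointly, so that only the oracle
    noise varies in the inner integral.\<close>
  let ?Z = "\<lambda>\<omega>. (X \<omega>, V \<omega>)"
  have Z: "?Z \<in> measurable P (?R \<Otimes>\<^sub>M borel)"
    using X V(1) by simp
  have ZM [measurable]: "?Z \<in> measurable M (?R \<Otimes>\<^sub>M borel)"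
    using XM V(2) by (intro measurable_Pair) (simp_all add: square_integrable_def)
  define \<phi> where "\<phi> = (\<lambda>q. (g (fst (fst q)) (snd q) - grad (fst (fst q))) \<bullet> snd (fst q))"
  have "(\<lambda>q. (fst (fst q), snd q)) \<in> measurable ((?R \<Otimes>\<^sub>M borel) \<Otimes>\<^sub>M D) (?R \<Otimes>\<^sub>M D)"
    by measurable
  from measurable_compose[OF this \<delta>]
  have \<phi>: "\<phi> \<in> borel_measurable ((?R \<Otimes>\<^sub>M borel) \<Otimes>\<^sub>M D)"
    unfolding \<phi>_def by (intro borel_measurable_inner) (simp_all add: split_beta')
  interpret Z: prob_space "distr M (?R \<Otimes>\<^sub>M borel) ?Z"
    by (rule prob_space_distr[OF ZM])
  interpret pair: pair_sigma_finite "distr M (?R \<Otimes>\<^sub>M borel) ?Z" D ..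
  note joint = distr_pair_fresh[OF fresh \<xi>(1) P Z, unfolded \<xi>(2)]
  have "integrable (distr M ((?R \<Otimes>\<^sub>M borel) \<Otimes>\<^sub>M D) (\<lambda>\<omega>. (?Z \<omega>, \<xi> \<omega>))) \<phi>"
    using square_integrable_inner[OF sq V(2)]
    by (subst integrable_distr_eq[OF measurable_Pair[OF ZM \<xi>(1)] \<phi>]) (simp add: \<phi>_def)
  then have int2: "integrable (distr M (?R \<Otimes>\<^sub>M borel) ?Z \<Otimes>\<^sub>M D) \<phi>"
    unfolding joint .
  have "(\<integral>\<omega>. ?\<delta> \<omega> \<bullet> V \<omega> \<partial>M) = (\<integral>q. \<phi> q \<partial>distr M ((?R \<Otimes>\<^sub>M borel) \<Otimes>\<^sub>M D) (\<lambda>\<omega>. (?Z \<omega>, \<xi> \<omega>)))"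
    by (subst integral_distr[OF measurable_Pair[OF ZM \<xi>(1)] \<phi>]) (simp add: \<phi>_def)
  also have "\<dots> = (\<integral>q. (\<integral>s. \<phi> (q, s) \<partial>D) \<partial>distr M (?R \<Otimes>\<^sub>M borel) ?Z)"
    unfolding joint using pair.integral_fst'[OF int2] by simp
  also have "\<dots> = (\<integral>q. 0 \<partial>distr M (?R \<Otimes>\<^sub>M borel) ?Z)"
  proof (rule Bochner_Integration.integral_cong[OF refl])
    fix q assume "q \<in> space (distr M (?R \<Otimes>\<^sub>M borel) ?Z)"
    then obtain y v where q: "q = (y, v)" "y \<in> S"
      by (auto simp: space_pair_measure S)
    have "(\<integral>s. (g y s - grad y) \<bullet> v \<partial>D) = (\<integral>s. g y s - grad y \<partial>D) \<bullet> v"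
      using unbiased[OF q(2)] by (intro integral_inner_left) auto
    also have "\<dots> = 0"
      using unbiased[OF q(2)] D.prob_space by simp
    finally show "(\<integral>s. \<phi> (q, s) \<partial>D) = 0"
      using q by (simp add: \<phi>_def)
  qed
  finally show "(\<integral>\<omega>. ?\<delta> \<omega> \<bullet> V \<omega> \<partial>M) = 0"
    by simp
qed

section \<open>Expectations with extended real values\<close>

lemma ereal_expectation_cong:
  "(\<And>\<omega>. \<omega> \<in> space M \<Longrightarrow> Y \<omega> = Z \<omega>) \<Longrightarrow> ereal_expectation M Y = ereal_expectation M Z"
  by (simp add: ereal_expectation_def cong: nn_integral_cong)

lemma ereal_expectation_not_integrable:
  assumes "Y \<in> borel_measurable M" "\<And>\<omega>. Y \<omega> \<ge> 0" "\<not> integrable M Y"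
  shows "ereal_expectation M (\<lambda>\<omega>. ereal (Y \<omega>)) = \<infinity>"
proof -
  have "(\<integral>\<^sup>+ \<omega>. ennreal (Y \<omega>) \<partial>M) = \<infinity>"
    using integrableI_nonneg[OF assms(1)] assms(2,3) by (auto simp flip: less_top)
  moreover have "e2ennreal (- ereal (Y \<omega>)) = 0" for \<omega>
    using assms(2)[of \<omega>] by (simp add: ennreal_neg)
  ultimately show ?thesis
    by (simp add: ereal_expectation_def e2ennreal_ereal)
qed

section \<open>Regret in expectation and pathwise descent\<close>

theorem theorem3p3:
  fixes f :: "'a::euclidean_space \<Rightarrow> real"
    and \<psi> :: "'a \<Rightarrow> ereal"
    and grad :: "'a \<Rightarrow> 'a"
    and L \<sigma> :: real
    and a \<gamma> :: "nat \<Rightarrow> real"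
    and x0 :: 'a
    and D :: "'s measure"
    and g :: "'a \<Rightarrow> 's \<Rightarrow> 'a"
    and M :: "'w measure"
    and \<xi> :: "nat \<Rightarrow> 'w \<Rightarrow> 's"
    and ghat X Xt :: "nat \<Rightarrow> 'w \<Rightarrow> 'a"
    and x :: 'a
    and T :: nat
  (* the composite problem; grad is the gradient of f *)
  assumes psi: "proper_closed_convex \<psi>"
    and f: "closed_convex_on (effective_dom \<psi>) f"
    and solution: "\<exists>xs. is_arg_min (composite f \<psi>) (\<lambda>y. y \<in> effective_dom \<psi>) xs"
    and grad: "\<And>y. y \<in> effective_dom \<psi> \<Longrightarrow> GDERIV f y :> grad y"
    and smooth: "L-lipschitz_on (effective_dom \<psi>) grad"
  (* the oracle; D is the distribution of the oracle noise *)
    and oracle_measurable: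
      "(\<lambda>(y, s). g y s) \<in> borel_measurable (restrict_space borel (effective_dom \<psi>) \<Otimes>\<^sub>M D)"
    and unbiased: "\<And>y. y \<in> effective_dom \<psi> \<Longrightarrow>
      integrable D (g y) \<and> (\<integral>s. g y s \<partial>D) = grad y"
    and variance: "\<And>y. y \<in> effective_dom \<psi> \<Longrightarrow>
      (\<integral>\<^sup>+ s. ennreal ((norm (g y s - grad y))\<^sup>2) \<partial>D) \<le> ennreal (\<sigma>\<^sup>2)"
  (* the samples: copies of the oracle noise, each independent of the past *)
    and prob: "prob_space M"
    and noise: "\<And>t. \<xi> t \<in> measurable M D \<and> distr M D (\<xi> t) = D"
    and ghat_measurable: "\<And>t. ghat t \<in> borel_measurable M"
    and fresh: "\<And>t. prob_space.indep_set M
      (sets (vimage_algebra (space M) (\<xi> t) D)) (sets (past M D \<xi> ghat t))"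
  (* parameters and the two sequences; \<gamma> (t - 1) is \<gamma> 0 for t = 0, as nat subtraction truncates *)
    and x0: "x0 \<in> effective_dom \<psi>"
    and a_pos: "\<And>t. a t > 0"
    and gamma_pos: "\<And>t. \<gamma> t > 0"
    and gamma_mono: "incseq \<gamma>"
    and gamma_ge: "\<And>t. \<gamma> (t - 1) \<ge> 4 * a t * L"
    and actual_iterates: "\<And>\<omega>. \<omega> \<in> space M \<Longrightarrow>
      da_iterates f \<psi> a \<gamma> x0 (\<lambda>t. X t \<omega>) (\<lambda>t. ghat t \<omega>) (\<lambda>t. X t \<omega>)"
    and virtual_iterates: "\<And>\<omega>. \<omega> \<in> space M \<Longrightarrow>
      da_iterates f \<psi> a \<gamma> x0 (\<lambda>t. X t \<omega>) (\<lambda>t. g (X t \<omega>) (\<xi> t \<omega>)) (\<lambda>t. Xt t \<omega>)"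
    and x: "x \<in> effective_dom \<psi>"
    and T: "T \<ge> 1"
  shows "((\<Sum>t<T. ereal_expectation M
              (\<lambda>\<omega>. ereal (a t) * (composite f \<psi> (Xt (Suc t) \<omega>) - composite f \<psi> x)))
          + ereal (\<gamma> (T - 1) / 2) * ereal_expectation M (\<lambda>\<omega>. ereal ((norm (x - Xt T \<omega>))\<^sup>2))
        \<le> ereal (\<gamma> (T - 1) / 2 * (norm (x - x0))\<^sup>2)
          + ereal L * (\<Sum>t<T. ereal (a t / (\<gamma> (t - 1))\<^sup>2) *
              ereal_expectation M (\<lambda>\<omega>. ereal ((norm
                (accumulated_error a (\<lambda>k. ghat k \<omega>) (\<lambda>k. g (X k \<omega>) (\<xi> k \<omega>)) t))\<^sup>2)))
          + ereal (\<Sum>t<T. (a t)\<^sup>2 * \<sigma>\<^sup>2 / \<gamma> (t - 1)))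
      \<and> (\<forall>\<omega>\<in>space M.
          let \<beta> = (\<lambda>t. (\<gamma> t - \<gamma> (t - 1)) / a t);
              \<rho> = (\<lambda>t. norm (X t \<omega> - x0));
              r = (\<lambda>t. norm (X (Suc t) \<omega> - X t \<omega>));
              F\<^sub>0 = composite f \<psi> x0 - (INF y\<in>effective_dom \<psi>. composite f \<psi> y)
          in ereal (\<Sum>t<T. (\<gamma> t + \<gamma> (t - 1) - a t * L) / (2 * a t) * (r t)\<^sup>2
                + (ghat t \<omega> - grad (X t \<omega>)) \<bullet> (X (Suc t) \<omega> - X t \<omega>))
             \<le> F\<^sub>0 + ereal (1 / 2 * (\<Sum>t<T. \<beta> t * (\<rho> t)\<^sup>2 - \<beta> t * (\<rho> (Suc t))\<^sup>2)))"
proof (intro conjI ballI)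
  interpret prob_space M by (rule prob)
  let ?S = "effective_dom \<psi>"
  let ?R = "restrict_space borel ?S"
  let ?h = "\<lambda>y. real_of_ereal (\<psi> y)"
  define F where "F y = f y + ?h y" for y
  define G where "G k \<omega> = g (X k \<omega>) (\<xi> k \<omega>)" for k \<omega>
  define \<delta> where "\<delta> k \<omega> = G k \<omega> - grad (X k \<omega>)" for k \<omega>
  define e where "e t \<omega> = accumulated_error a (\<lambda>k. ghat k \<omega>) (\<lambda>k. G k \<omega>) t" for t \<omega>
  have fS: "convex_on ?S f"
    using f by (simp add: closed_convex_on_def)
  have L: "L \<ge> 0"
    by (rule lipschitz_on_nonneg[OF smooth])
  note actual = actual_iterates
  have virtual: "\<And>\<omega>. \<omega> \<in> space M \<Longrightarrow> da_iterates f \<psi> a \<gamma> x0 (\<lambda>t. X t \<omega>) (\<lambda>t. G t \<omega>) (\<lambda>t. Xt t \<omega>)"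
    using virtual_iterates by (simp add: G_def)
  have XS: "X t \<omega> \<in> ?S" if "\<omega> \<in> space M" for t \<omega>
    by (rule da_iterates_strong_min(1)[OF psi x0 a_pos gamma_pos actual[OF that]])
  have XtS: "Xt t \<omega> \<in> ?S" if "\<omega> \<in> space M" for t \<omega>
    by (rule da_iterates_strong_min(1)[OF psi x0 a_pos gamma_pos virtual[OF that]])
  have composite: "composite f \<psi> y = ereal (F y)" if "y \<in> ?S" for y
    using proper_real_of_ereal[OF psi that] unfolding composite_def F_def by (metis plus_ereal.simps(1))
  \<comment> \<open>The solution serves twice: it makes the infimum an attained real number, and it
    bounds \<open>F\<close> from below when integrability of the regret terms is shown.\<close>
  from solution obtain xs where xs: "xs \<in> ?S" and xs_min: "\<And>y. y \<in> ?S \<Longrightarrow> F xs \<le> F y"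
    by (auto simp: is_arg_min_linorder composite)

  \<comment> \<open>The descent bound for every outcome\<close>
  {
    fix \<omega> assume \<omega>: "\<omega> \<in> space M"
    have "(INF y\<in>?S. composite f \<psi> y) = ereal (F xs)"
      using xs xs_min composite by (intro INF_eqI) auto
    moreover have "F x0 - F (X T \<omega>) \<le> F x0 - F xs"
      using xs_min[OF XS[OF \<omega>]] by simp
    ultimately show "let \<beta> = (\<lambda>t. (\<gamma> t - \<gamma> (t - 1)) / a t);
              \<rho> = (\<lambda>t. norm (X t \<omega> - x0));
              r = (\<lambda>t. norm (X (Suc t) \<omega> - X t \<omega>));
              F\<^sub>0 = composite f \<psi> x0 - (INF y\<in>effective_dom \<psi>. composite f \<psi> y)
          in ereal (\<Sum>t<T. (\<gamma> t + \<gamma> (t - 1) - a t * L) / (2 * a t) * (r t)\<^sup>2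
                + (ghat t \<omega> - grad (X t \<omega>)) \<bullet> (X (Suc t) \<omega> - X t \<omega>))
             \<le> F\<^sub>0 + ereal (1 / 2 * (\<Sum>t<T. \<beta> t * (\<rho> t)\<^sup>2 - \<beta> t * (\<rho> (Suc t))\<^sup>2))"
      using da_iterates_descent[OF psi grad smooth x0 a_pos gamma_pos actual[OF \<omega>], of T]
      unfolding Let_def composite[OF x0] F_def[symmetric] by simp
  }

  \<comment> \<open>Measurability of the iterates and moments of the noise\<close>
  have grad_meas: "grad \<in> borel_measurable ?R"
    by (intro borel_measurable_continuous_on_restrict lipschitz_on_continuous_on[OF smooth])
  have X_meas: "X t \<in> measurable N ?R" if "space N = space M" "\<And>k. k < t \<Longrightarrow> ghat k \<in> borel_measurable N" for N t
    by (rule da_iterates_measurable[OF psi x0 a_pos gamma_pos actual[folded that(1)] that(2)])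
  have G_meas: "G k \<in> borel_measurable N" if "X k \<in> measurable N ?R" "\<xi> k \<in> measurable N D" for N k
    using measurable_compose[OF measurable_Pair[OF that] oracle_measurable] by (simp add: G_def[abs_def])
  have Xt_meas: "Xt t \<in> measurable N ?R" if "space N = space M" "\<And>k. k < t \<Longrightarrow> G k \<in> borel_measurable N" for N t
    by (rule da_iterates_measurable[OF psi x0 a_pos gamma_pos virtual[folded that(1)] that(2)])
  have X_M: "X t \<in> measurable M ?R" for t
    by (rule X_meas) (simp_all add: ghat_measurable)
  have G_M [measurable]: "G t \<in> borel_measurable M" for t
    using G_meas[OF X_M] noise by blast
  have Xt_M: "Xt t \<in> measurable M ?R" for t
    by (rule Xt_meas) simp_all
  have X_B [measurable]: "X t \<in> borel_measurable M" and Xt_B [measurable]: "Xt t \<in> borel_measurable M" for t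
    using X_M Xt_M by (auto simp: measurable_restrict_space2_iff)
  have \<xi>: "\<And>t. \<xi> t \<in> measurable M D" "\<And>t. distr M D (\<xi> t) = D"
    using noise by auto
  note past = measurable_past[where \<xi> = \<xi> and ghat = ghat, OF \<xi>(1) ghat_measurable]
  \<comment> \<open>The query point \<open>X t\<close> uses only estimates with index below
    \<open>t\<close>, so it is already fixed before the sample \<open>\<xi> t\<close> is
    drawn.\<close>
  have X_past: "X k \<in> measurable (past M D \<xi> ghat t) ?R" if "k \<le> t" for k t
    by (rule X_meas) (use that in \<open>auto intro: past\<close>)
  \<comment> \<open>The virtual iterate uses the gradients \<open>G k\<close> with
    \<open>k < t\<close>, whose query points and samples both belong to the past.\<close>
  have Xt_past: "Xt t \<in> measurable (past M D \<xi> ghat t) ?R" for t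
    by (rule Xt_meas) (auto intro!: G_meas X_past past)
  have Xt_past_B: "Xt t \<in> borel_measurable (past M D \<xi> ghat t)" for t
    using Xt_past[of t] by (simp add: measurable_restrict_space2_iff)
  note moments = noise_moments[OF oracle_measurable grad_meas unbiased variance fresh \<xi> space_past X_past[OF order_refl],
      folded G_def \<delta>_def]
  have e_meas [measurable]: "e t \<in> borel_measurable M" for t
    unfolding e_def[abs_def] accumulated_error_def using ghat_measurable by measurable

  \<comment> \<open>The regret bound in expectation\<close>
  show "(\<Sum>t<T. ereal_expectation M
              (\<lambda>\<omega>. ereal (a t) * (composite f \<psi> (Xt (Suc t) \<omega>) - composite f \<psi> x)))
          + ereal (\<gamma> (T - 1) / 2) * ereal_expectation M (\<lambda>\<omega>. ereal ((norm (x - Xt T \<omega>))\<^sup>2))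
        \<le> ereal (\<gamma> (T - 1) / 2 * (norm (x - x0))\<^sup>2)
          + ereal L * (\<Sum>t<T. ereal (a t / (\<gamma> (t - 1))\<^sup>2) *
              ereal_expectation M (\<lambda>\<omega>. ereal ((norm
                (accumulated_error a (\<lambda>k. ghat k \<omega>) (\<lambda>k. g (X k \<omega>) (\<xi> k \<omega>)) t))\<^sup>2)))
          + ereal (\<Sum>t<T. (a t)\<^sup>2 * \<sigma>\<^sup>2 / \<gamma> (t - 1))"
  \<comment> \<open>The case \<open>L = 0\<close> is separated because zero times infinity is 0 in
    \<open>ereal\<close>: an error without second moment then does not make the right-hand side
    infinite.\<close>
  proof (cases "L = 0 \<or> (\<forall>t<T. integrable M (\<lambda>\<omega>. (norm (e t \<omega>))\<^sup>2))")
    case False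
    then obtain t where t: "t < T" "\<not> integrable M (\<lambda>\<omega>. (norm (e t \<omega>))\<^sup>2)" and "L > 0"
      using L by auto
    then have "ereal_expectation M (\<lambda>\<omega>. ereal ((norm (e t \<omega>))\<^sup>2)) = \<infinity>"
      by (intro ereal_expectation_not_integrable) simp_all
    then have "(\<Sum>t<T. ereal (a t / (\<gamma> (t - 1))\<^sup>2) * ereal_expectation M (\<lambda>\<omega>. ereal ((norm (e t \<omega>))\<^sup>2))) = \<infinity>"
      unfolding sum_Pinfty using t(1) a_pos[of t] gamma_pos[of "t - 1"] by (auto intro!: bexI[of _ t])
    then show ?thesis
      unfolding G_def[symmetric] e_def[symmetric] using \<open>L > 0\<close> by simp
  next
    case True
    \<comment> \<open>Strong induction: each earlier \<open>G k\<close> is the sum of the gradient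
      difference from \<open>x0\<close>, the constant \<open>grad x0\<close> and the noise. The
      difference is controlled by \<open>X k - x0\<close>, hence by \<open>e k\<close> and the
      earlier \<open>Xt k\<close>.\<close>
    have Xt_sq: "square_integrable M (Xt t)" if "t \<le> T" for t
      using that
    proof (induction t rule: less_induct)
      case (less t)
      have G_sq: "square_integrable M (G k)" if k: "k < t" for k
      proof -
        have "square_integrable M (\<lambda>\<omega>. grad (X k \<omega>) - grad x0)"
        proof (cases "L = 0")
          case L0: True
          \<comment> \<open>With \<open>L = 0\<close> the gradient is constant on the domain, so the
            difference is dominated by zero times a constant.\<close>
          show ?thesis
          proof (rule square_integrable_dominated[OF _ square_integrable_const])
            show "(\<lambda>\<omega>. grad (X k \<omega>) - grad x0) \<in> borel_measurable M"
              using measurable_compose[OF X_M grad_meas] by simp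
            show "norm (grad (X k \<omega>) - grad x0) \<le> 0 * norm x0" if "\<omega> \<in> space M" for \<omega>
              using lipschitz_onD[OF smooth XS[OF that] x0] L0 by (simp add: dist_norm)
          qed
        next
          case L1: False
          have "square_integrable M (e k)"
            using True L1 k less.prems by (simp add: square_integrable_def)
          then have "square_integrable M (\<lambda>\<omega>. X k \<omega> - Xt k \<omega>)"
          proof (rule square_integrable_dominated[rotated])
            fix \<omega> assume \<omega>: "\<omega> \<in> space M"
            show "norm (X k \<omega> - Xt k \<omega>) \<le> 1 / \<gamma> (k - 1) * norm (e k \<omega>)"
              using da_iterates_lipschitz[OF psi x0 a_pos gamma_pos actual[OF \<omega>] virtual[OF \<omega>], of k]
              by (simp add: e_def accumulated_error_def scaleR_diff_right sum_subtractf)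
          qed measurable
          from square_integrable_add[OF square_integrable_add[OF this less.IH[OF k]] square_integrable_const[of "- x0"]]
          have "square_integrable M (\<lambda>\<omega>. X k \<omega> - x0)"
            using k less.prems by simp
          then show ?thesis
          proof (rule square_integrable_dominated[rotated])
            show "(\<lambda>\<omega>. grad (X k \<omega>) - grad x0) \<in> borel_measurable M"
              using measurable_compose[OF X_M grad_meas] by simp
            show "norm (grad (X k \<omega>) - grad x0) \<le> L * norm (X k \<omega> - x0)" if "\<omega> \<in> space M" for \<omega>
              using lipschitz_onD[OF smooth XS[OF that] x0] by (simp add: dist_norm)
          qed
        qed
        from square_integrable_add[OF square_integrable_add[OF this square_integrable_const[of "grad x0"]] moments(1)[of k]]
        show ?thesis
          by (simp add: \<delta>_def)
      qed
      \<comment> \<open>A fixed outcome provides a reference run of the method, against which the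
        Lipschitz bound controls \<open>Xt t\<close> for all outcomes.\<close>
      obtain \<omega>\<^sub>0 where \<omega>\<^sub>0: "\<omega>\<^sub>0 \<in> space M"
        using not_empty by blast
      define s where "s \<omega> = (\<Sum>k<t. a k *\<^sub>R G k \<omega>)" for \<omega>
      have "square_integrable M s"
        unfolding s_def[abs_def] by (intro square_integrable_sum square_integrable_scaleR G_sq) simp
      from square_integrable_add[OF this square_integrable_const[of "- s \<omega>\<^sub>0"]]
      have "square_integrable M (\<lambda>\<omega>. s \<omega> - s \<omega>\<^sub>0)"
        by simp
      then have "square_integrable M (\<lambda>\<omega>. Xt t \<omega> - Xt t \<omega>\<^sub>0)"
      proof (rule square_integrable_dominated[rotated])
        fix \<omega> assume \<omega>: "\<omega> \<in> space M"
        show "norm (Xt t \<omega> - Xt t \<omega>\<^sub>0) \<le> 1 / \<gamma> (t - 1) * norm (s \<omega> - s \<omega>\<^sub>0)"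
          using da_iterates_lipschitz[OF psi x0 a_pos gamma_pos virtual[OF \<omega>] virtual[OF \<omega>\<^sub>0], of t]
          by (simp add: s_def)
      qed measurable
      from square_integrable_add[OF this square_integrable_const[of "Xt t \<omega>\<^sub>0"]]
      show ?case by simp
    qed
    have dev_sq: "square_integrable M (\<lambda>\<omega>. Xt t \<omega> - x)" if "t \<le> T" for t
      using square_integrable_add[OF Xt_sq[OF that] square_integrable_const[of "- x"]] by simp
    define Y where "Y t \<omega> = a t * (F (Xt (Suc t) \<omega>) - F x)" for t \<omega>
    \<comment> \<open>A deterministic lower bound for \<open>Y t\<close>, obtained by replacing the
      virtual iterate by the solution \<open>xs\<close>.\<close>
    define m where "m t = a t * (F xs - F x)" for t
    define E where "E t \<omega> = L * (a t / (\<gamma> (t - 1))\<^sup>2 * (norm (e t \<omega>))\<^sup>2)" for t \<omega>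
    define Q where "Q \<omega> = \<gamma> (T - 1) / 2 * (norm (x - x0))\<^sup>2
      + (\<Sum>t<T. E t \<omega>) + (\<Sum>t<T. (a t)\<^sup>2 / \<gamma> (t - 1) * (norm (\<delta> t \<omega>))\<^sup>2)
      - (\<Sum>t<T. a t * (\<delta> t \<omega> \<bullet> (Xt t \<omega> - x)))" for \<omega>
    have regret: "(\<Sum>t<T. Y t \<omega>) + \<gamma> (T - 1) / 2 * (norm (x - Xt T \<omega>))\<^sup>2 \<le> Q \<omega>" if "\<omega> \<in> space M" for \<omega>
      using da_iterates_virtual_regret[OF psi fS grad smooth x0 a_pos gamma_pos gamma_mono gamma_ge
          actual[OF that] virtual[OF that] x, of T]
      unfolding Y_def Q_def E_def F_def \<delta>_def e_def sum_distrib_left .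
    have E_int: "integrable M (E t)" if "t < T" for t
      unfolding E_def[abs_def] using True that by (cases "L = 0") auto
    have \<delta>_int: "integrable M (\<lambda>\<omega>. (norm (\<delta> t \<omega>))\<^sup>2)" for t
      using moments(1)[of t] by (simp add: square_integrable_def)
    have cross_int: "integrable M (\<lambda>\<omega>. \<delta> t \<omega> \<bullet> (Xt t \<omega> - x))" if "t < T" for t
      by (rule square_integrable_inner[OF moments(1) dev_sq[OF less_imp_le[OF that]]])
    \<comment> \<open>The deviation \<open>Xt t - x\<close> is measurable with respect to the past,
      so the fresh noise is orthogonal to it.\<close>
    have cross: "(\<integral>\<omega>. \<delta> t \<omega> \<bullet> (Xt t \<omega> - x) \<partial>M) = 0" if "t < T" for t
      using Xt_past_B by (intro moments(3) dev_sq less_imp_le[OF that] borel_measurable_diff) simp_all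
    have const: "has_bochner_integral M (\<lambda>_. c) c" for c :: real
      by (simp add: has_bochner_integral_iff prob_space)
    have "has_bochner_integral M Q (\<gamma> (T - 1) / 2 * (norm (x - x0))\<^sup>2 + (\<Sum>t<T. \<integral>\<omega>. E t \<omega> \<partial>M)
        + (\<Sum>t<T. (a t)\<^sup>2 / \<gamma> (t - 1) * (\<integral>\<omega>. (norm (\<delta> t \<omega>))\<^sup>2 \<partial>M)) - (\<Sum>t<T. a t * 0))"
      unfolding Q_def[abs_def]
      by (intro const has_bochner_integral_add has_bochner_integral_diff has_bochner_integral_sum
          has_bochner_integral_mult_right) (simp_all add: has_bochner_integral_iff E_int \<delta>_int cross_int cross)
    then have Q_int: "integrable M Q" and "(\<integral>\<omega>. Q \<omega> \<partial>M) = \<gamma> (T - 1) / 2 * (norm (x - x0))\<^sup>2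
        + (\<Sum>t<T. \<integral>\<omega>. E t \<omega> \<partial>M) + (\<Sum>t<T. (a t)\<^sup>2 / \<gamma> (t - 1) * (\<integral>\<omega>. (norm (\<delta> t \<omega>))\<^sup>2 \<partial>M))"
      by (simp_all add: has_bochner_integral_iff)
    note this(2)
    also have "(\<Sum>t<T. (a t)\<^sup>2 / \<gamma> (t - 1) * (\<integral>\<omega>. (norm (\<delta> t \<omega>))\<^sup>2 \<partial>M)) \<le> (\<Sum>t<T. (a t)\<^sup>2 / \<gamma> (t - 1) * \<sigma>\<^sup>2)"
      using moments(2) gamma_pos by (intro sum_mono mult_left_mono) (simp_all add: less_imp_le)
    finally have Q_le: "(\<integral>\<omega>. Q \<omega> \<partial>M) \<le> \<gamma> (T - 1) / 2 * (norm (x - x0))\<^sup>2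
        + (\<Sum>t<T. \<integral>\<omega>. E t \<omega> \<partial>M)
        + (\<Sum>t<T. (a t)\<^sup>2 * \<sigma>\<^sup>2 / \<gamma> (t - 1))"
      by simp
    \<comment> \<open>On the domain, \<open>f\<close> is continuous because it is differentiable
      there, and \<psi> is Borel because its sublevel sets are closed; this gives measurability of
      \<open>F\<close>.\<close>
    have "isCont f y" if "y \<in> ?S" for y
      using grad[OF that] by (auto simp: gderiv_def intro: has_derivative_continuous)
    then have "f \<in> borel_measurable ?R"
      by (intro borel_measurable_continuous_on_restrict continuous_at_imp_continuous_on) simp
    moreover have "?h \<in> borel_measurable ?R"
      using borel_measurable_closed_convex[OF psi] by (intro measurable_restrict_space1) measurable
    ultimately have "F \<in> borel_measurable ?R"
      unfolding F_def[abs_def] by measurable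
    then have Y_meas [measurable]: "Y t \<in> borel_measurable M" for t
      using measurable_compose[OF Xt_M \<open>F \<in> borel_measurable ?R\<close>] unfolding Y_def[abs_def] by measurable
    have Y_ge: "m t \<le> Y t \<omega>" if "\<omega> \<in> space M" for t \<omega>
      using xs_min[OF XtS[OF that]] a_pos[of t] by (simp add: m_def Y_def)
    \<comment> \<open>All \<open>Y s - m s\<close> and the distance term are nonnegative, so the
      pathwise bound on their sum dominates each single one by an integrable function.\<close>
    have Y_int: "integrable M (Y t)" if t: "t < T" for t
    proof -
      have "integrable M (\<lambda>\<omega>. Q \<omega> - (\<Sum>s<T. m s))"
        using Q_int by simp
      then have "integrable M (\<lambda>\<omega>. Y t \<omega> - m t)"
      proof (rule Bochner_Integration.integrable_bound)
        show "AE \<omega> in M. norm (Y t \<omega> - m t) \<le> norm (Q \<omega> - (\<Sum>s<T. m s))"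
        proof (rule AE_I2)
          fix \<omega> assume \<omega>: "\<omega> \<in> space M"
          have "Y t \<omega> - m t \<le> (\<Sum>s<T. Y s \<omega> - m s)"
            using t Y_ge[OF \<omega>] by (intro member_le_sum) auto
          moreover have "0 \<le> \<gamma> (T - 1) / 2 * (norm (x - Xt T \<omega>))\<^sup>2"
            using gamma_pos[of "T - 1"] by simp
          ultimately show "norm (Y t \<omega> - m t) \<le> norm (Q \<omega> - (\<Sum>s<T. m s))"
            using regret[OF \<omega>] Y_ge[OF \<omega>, of t] unfolding sum_subtractf real_norm_def by linarith
        qed
      qed measurable
      from Bochner_Integration.integrable_add[OF this integrable_const[of "m t"]]
      show ?thesis by simp
    qed
    have dist_int: "integrable M (\<lambda>\<omega>. (norm (x - Xt T \<omega>))\<^sup>2)"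
      using dev_sq[of T] by (simp add: square_integrable_def norm_minus_commute)
    have lhs: "has_bochner_integral M (\<lambda>\<omega>. (\<Sum>t<T. Y t \<omega>) + \<gamma> (T - 1) / 2 * (norm (x - Xt T \<omega>))\<^sup>2)
        ((\<Sum>t<T. \<integral>\<omega>. Y t \<omega> \<partial>M) + \<gamma> (T - 1) / 2 * (\<integral>\<omega>. (norm (x - Xt T \<omega>))\<^sup>2 \<partial>M))"
      by (intro has_bochner_integral_add has_bochner_integral_sum has_bochner_integral_mult_right)
        (simp_all add: has_bochner_integral_iff Y_int dist_int)
    have main: "(\<Sum>t<T. \<integral>\<omega>. Y t \<omega> \<partial>M) + \<gamma> (T - 1) / 2 * (\<integral>\<omega>. (norm (x - Xt T \<omega>))\<^sup>2 \<partial>M)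
        \<le> (\<integral>\<omega>. Q \<omega> \<partial>M)"
      unfolding has_bochner_integral_integral_eq[OF lhs, symmetric]
      by (rule integral_mono[OF _ Q_int regret]) (use lhs in \<open>simp_all add: has_bochner_integral_iff\<close>)
    have Y_exp: "ereal_expectation M (\<lambda>\<omega>. ereal (a t) * (composite f \<psi> (Xt (Suc t) \<omega>) - composite f \<psi> x))
        = ereal (\<integral>\<omega>. Y t \<omega> \<partial>M)" if "t < T" for t
    proof -
      have "ereal_expectation M (\<lambda>\<omega>. ereal (a t) * (composite f \<psi> (Xt (Suc t) \<omega>) - composite f \<psi> x))
          = ereal_expectation M (\<lambda>\<omega>. ereal (Y t \<omega>))"
        by (rule ereal_expectation_cong) (simp add: composite XtS x Y_def)
      then show ?thesis
        using ereal_expectation_ereal[OF Y_int[OF that]] by simp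
    qed
    \<comment> \<open>For \<open>L = 0\<close> both sides vanish, even if some expectation on the
      left is infinite; otherwise all errors have finite second moments and the computation is
      real.\<close>
    have e_exp: "ereal L * (\<Sum>t<T. ereal (a t / (\<gamma> (t - 1))\<^sup>2) * ereal_expectation M (\<lambda>\<omega>. ereal ((norm (e t \<omega>))\<^sup>2)))
        = ereal (\<Sum>t<T. \<integral>\<omega>. E t \<omega> \<partial>M)"
    proof (cases "L = 0")
      case L1: False
      then have "(\<Sum>t<T. ereal (a t / (\<gamma> (t - 1))\<^sup>2) * ereal_expectation M (\<lambda>\<omega>. ereal ((norm (e t \<omega>))\<^sup>2)))
          = (\<Sum>t<T. ereal (a t / (\<gamma> (t - 1))\<^sup>2 * (\<integral>\<omega>. (norm (e t \<omega>))\<^sup>2 \<partial>M)))"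
        using True by (intro sum.cong) (simp_all add: ereal_expectation_ereal)
      then show ?thesis
        by (simp add: sum_distrib_left E_def)
    qed (simp add: E_def flip: zero_ereal_def)
    show ?thesis
      unfolding G_def[symmetric] e_def[symmetric] e_exp using main Q_le by (simp add: Y_exp ereal_expectation_ereal[OF dist_int])
  qed
qed

end
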